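(* Let $\mathscr{H}$ be the Hilbert space of an open quantum system with uniformly continuous quantum dynamical semigroup $(\mathcal{T}_t)_{t\ge0}$ on $\mathfrak{B}(\mathscr{H})$, and let $\mathscr{C}_\ast\subseteq\mathfrak{S}(\mathscr{H})$ be the set of all invariant density operators of $(\mathcal{T}_t)_{t\ge 0}$. Then $\mathscr{C}_\ast$ is convex and is closed in the Banach space $(\mathfrak{I}_1(\mathscr{H}),\|\cdot\|_1)$.
   Context: $\mathfrak{B}(\mathscr{H})$ is the algebra of bounded operators on $\mathscr{H}$. $\mathfrak{I}_1(\mathscr{H})$ is the space of trace-class operators, with norm $\|X\|_1=\operatorname{tr}(|X|)$. $\mathfrak{S}(\mathscr{H})$ is the set of density operators (positive trace-class operators with trace $1$). A quantum dynamical semigroup on $\mathfrak{B}(\mathscr{H})$ is a family of bounded linear maps $(\mathcal{T}_t)_{t\ge0}$ on $\mathfrak{B}(\mathscr{H})$ such that $\mathcal{T}_0=\mathrm{id}$, $\mathcal{T}_{s+t}=\mathcal{T}_s\circ\mathcal{T}_t$ for all $s,t\ge0$, and each $\mathcal{T}_t$ is completely positive and normally continuous. For the semigroup of an open quantum system, $\mathcal{T}_t(1)=1$, and there is a dual semigroup $(\mathcal{S}_t)_{t\ge 0}$ mapping density operators to density operators with $\operatorname{tr}(X\mathcal{S}_t(\rho))=\operatorname{tr}(\mathcal{T}_t(X)\rho)$ for all $X\in\mathfrak{B}(\mathscr{H})$; both semigroups are assumed uniformly continuous. A density operator $\rho$ is invariant for $(\mathcal{T}_t)$ if $\operatorname{tr}(\rho\,\mathcal{T}_t(A))=\operatorname{tr}(\rho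 A)$ for all $A\in\mathfrak{B}(\mathscr{H})$ and all $t\ge0$. *)

theory Defs
  imports "HOL-Analysis.Analysis"
begin

section \<open>Complex Hilbert spaces\<close>

class complex_vector = real_vector +
  fixes scaleC :: "complex \<Rightarrow> 'a \<Rightarrow> 'a"  (infixr \<open>*\<^sub>C\<close> 75)
  assumes scaleC_add_right: "c *\<^sub>C (x + y) = c *\<^sub>C x + c *\<^sub>C y"
    and scaleC_add_left: "(c + d) *\<^sub>C x = c *\<^sub>C x + d *\<^sub>C x"
    and scaleC_scaleC: "c *\<^sub>C d *\<^sub>C x = (c * d) *\<^sub>C x"
    and scaleR_scaleC: "r *\<^sub>R x = complex_of_real r *\<^sub>C x"

text \<open>The inner product is antilinear in its first argument. Completeness comes from
  the class \<^class>\<open>banach\<close>; no separability or nontriviality is assumed.\<close>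

class complex_hilbert_space = banach + complex_vector +
  fixes cinner :: "'a \<Rightarrow> 'a \<Rightarrow> complex"
  assumes cinner_commute: "cinner x y = cnj (cinner y x)"
    and cinner_add_right: "cinner x (y + z) = cinner x y + cinner x z"
    and cinner_scaleC_right: "cinner x (c *\<^sub>C y) = c * cinner x y"
    and cinner_self: "cinner x x = complex_of_real ((norm x)\<^sup>2)"

lemma norm_scaleC: "norm (c *\<^sub>C x) = cmod c * norm (x :: 'a::complex_hilbert_space)"
proof -
  have "cinner (c *\<^sub>C x) x = cnj c * cinner x x"
    by (metis cinner_commute cinner_scaleC_right complex_cnj_mult)
  then have "cinner (c *\<^sub>C x) (c *\<^sub>C x) = c * cnj c * cinner x x"
    by (simp add: cinner_scaleC_right)
  then have "complex_of_real ((norm (c *\<^sub>C x))\<^sup>2) = complex_of_real ((cmod c * norm x)\<^sup>2)"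
    by (simp only: cinner_self complex_norm_square[symmetric] power_mult_distrib of_real_mult)
  then have "(norm (c *\<^sub>C x))\<^sup>2 = (cmod c * norm x)\<^sup>2"
    using of_real_eq_iff by blast
  then show ?thesis
    by (rule power2_eq_imp_eq) auto
qed

lemma bounded_linear_scaleC: "bounded_linear (scaleC c :: 'a \<Rightarrow> 'a::complex_hilbert_space)"
proof (rule bounded_linear_intro[where K = "cmod c"])
  fix r and x :: 'a
  show "c *\<^sub>C r *\<^sub>R x = r *\<^sub>R c *\<^sub>C x"
    by (simp add: scaleR_scaleC scaleC_scaleC mult.commute)
qed (simp_all add: scaleC_add_right norm_scaleC mult.commute)

instantiation complex :: complex_hilbert_space
begin

definition scaleC_complex :: "complex \<Rightarrow> complex \<Rightarrow> complex"
  where "scaleC_complex = (*)"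

definition cinner_complex :: "complex \<Rightarrow> complex \<Rightarrow> complex"
  where "cinner_complex x y = cnj x * y"

instance
proof
  fix x :: complex
  show "cinner x x = complex_of_real ((norm x)\<^sup>2)"
    unfolding cinner_complex_def by (metis complex_norm_square mult.commute)
qed (simp_all add: scaleC_complex_def cinner_complex_def scaleR_conv_of_real algebra_simps)

end


section \<open>Bounded operators\<close>

text \<open>The elements of \<^typ>\<open>'a \<Rightarrow>\<^sub>L 'a\<close> are only real-linear; the type of bounded operators
  consists of the complex-linear ones, with the operator norm inherited from there.\<close>

typedef (overloaded) 'a bop =
  "{A :: 'a::complex_hilbert_space \<Rightarrow>\<^sub>L 'a. \<forall>c x. A (c *\<^sub>C x) = c *\<^sub>C A x}"
  morphisms bop_blinfun Bop
proof -
  have "c *\<^sub>C (0::'a) = 0" for c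
    using norm_scaleC[of c "0::'a"] by simp
  then show ?thesis by (intro exI[of _ 0]) simp
qed

setup_lifting type_definition_bop

lift_definition bop_apply :: "'a::complex_hilbert_space bop \<Rightarrow> 'a \<Rightarrow> 'a" (infixr \<open>\<cdot>\<close> 90)
  is "blinfun_apply" .

instantiation bop :: (complex_hilbert_space) real_normed_vector
begin

lift_definition zero_bop :: "'a bop" is "0"
  using norm_scaleC[of _ "0::'a"] by simp
lift_definition plus_bop :: "'a bop \<Rightarrow> 'a bop \<Rightarrow> 'a bop" is "(+)"
  by (simp add: blinfun.add_left scaleC_add_right)
lift_definition scaleR_bop :: "real \<Rightarrow> 'a bop \<Rightarrow> 'a bop" is "scaleR"
  by (simp add: blinfun.scaleR_left scaleR_scaleC scaleC_scaleC mult.commute)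
lift_definition minus_bop :: "'a bop \<Rightarrow> 'a bop \<Rightarrow> 'a bop" is "(-)"
  by (simp add: blinfun.diff_left linear_diff[OF bounded_linear.linear[OF bounded_linear_scaleC]])
lift_definition uminus_bop :: "'a bop \<Rightarrow> 'a bop" is "uminus"
  by (simp add: blinfun.minus_left linear_neg[OF bounded_linear.linear[OF bounded_linear_scaleC]])
lift_definition norm_bop :: "'a bop \<Rightarrow> real" is "norm" .

definition dist_bop :: "'a bop \<Rightarrow> 'a bop \<Rightarrow> real"
  where "dist_bop A B = norm (A - B)"
definition sgn_bop :: "'a bop \<Rightarrow> 'a bop"
  where "sgn_bop A = scaleR (inverse (norm A)) A"
definition uniformity_bop :: "('a bop \<times> 'a bop) filter"
  where "uniformity_bop = (INF e\<in>{0<..}. principal {(A, B). dist A B < e})"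
definition open_bop :: "'a bop set \<Rightarrow> bool"
  where "open_bop U \<longleftrightarrow> (\<forall>A\<in>U. \<forall>\<^sub>F (A', B) in uniformity. A' = A \<longrightarrow> B \<in> U)"

instance
proof
  fix A B C :: "'a bop" and r s :: real
  show "A + B + C = A + (B + C)" "A + B = B + A" "0 + A = A" "- A + A = 0" "A - B = A + - B"
    by (transfer, simp)+
  show "r *\<^sub>R (A + B) = r *\<^sub>R A + r *\<^sub>R B" "(r + s) *\<^sub>R A = r *\<^sub>R A + s *\<^sub>R A"
    "r *\<^sub>R s *\<^sub>R A = (r * s) *\<^sub>R A" "1 *\<^sub>R A = A"
    by (transfer, simp add: algebra_simps)+
  show "norm A = 0 \<longleftrightarrow> A = 0" "norm (A + B) \<le> norm A + norm B" "norm (r *\<^sub>R A) = \<bar>r\<bar> * norm A"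
    by (transfer, simp add: norm_triangle_ineq)+
qed (simp_all add: dist_bop_def sgn_bop_def uniformity_bop_def open_bop_def)

end

instantiation bop :: (complex_hilbert_space) complex_vector
begin

lift_definition scaleC_bop :: "complex \<Rightarrow> 'a bop \<Rightarrow> 'a bop"
  is "\<lambda>c A. Blinfun (scaleC c) o\<^sub>L A"
  by (simp add: bounded_linear_Blinfun_apply[OF bounded_linear_scaleC] scaleC_scaleC mult.commute)

instance
proof
  fix c d :: complex and r :: real and A B :: "'a bop"
  show "c *\<^sub>C (A + B) = c *\<^sub>C A + c *\<^sub>C B" "(c + d) *\<^sub>C A = c *\<^sub>C A + d *\<^sub>C A"
    "c *\<^sub>C d *\<^sub>C A = (c * d) *\<^sub>C A" "r *\<^sub>R A = complex_of_real r *\<^sub>C A"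
    by (transfer, rule blinfun_eqI, simp add: blinfun.bilinear_simps scaleC_add_left
        scaleC_add_right scaleC_scaleC scaleR_scaleC bounded_linear_Blinfun_apply[OF bounded_linear_scaleC])+
qed

end

text \<open>Multiplication of operators is composition.\<close>

instantiation bop :: (complex_hilbert_space) "{real_normed_algebra, monoid_mult}"
begin

lift_definition one_bop :: "'a bop" is "id_blinfun" by simp
lift_definition times_bop :: "'a bop \<Rightarrow> 'a bop \<Rightarrow> 'a bop" is "(o\<^sub>L)" by simp

instance
proof
  show "norm (A * B) \<le> norm A * norm B" for A B :: "'a bop"
    by transfer (rule norm_blinfun_compose)
qed (transfer, rule blinfun_eqI, simp add: blinfun.bilinear_simps)+

end

lemma bop_apply_simps:
  fixes A B :: "'a::complex_hilbert_space bop"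
  shows "0 \<cdot> x = 0" "1 \<cdot> x = x" "(A + B) \<cdot> x = A \<cdot> x + B \<cdot> x" "(A - B) \<cdot> x = A \<cdot> x - B \<cdot> x"
    "(A * B) \<cdot> x = A \<cdot> B \<cdot> x" "(c *\<^sub>C A) \<cdot> x = c *\<^sub>C A \<cdot> x" "(r *\<^sub>R A) \<cdot> x = r *\<^sub>R A \<cdot> x"
    "A \<cdot> (x + y) = A \<cdot> x + A \<cdot> y" "A \<cdot> (c *\<^sub>C x) = c *\<^sub>C A \<cdot> x"
  by (transfer, simp add: blinfun.bilinear_simps bounded_linear_Blinfun_apply[OF bounded_linear_scaleC])+

definition adjoint_op :: "'a::complex_hilbert_space bop \<Rightarrow> 'a bop"
  where "adjoint_op A = (THE B. \<forall>x y. cinner (B \<cdot> x) y = cinner x (A \<cdot> y))"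

definition positive_op :: "'a::complex_hilbert_space bop \<Rightarrow> bool"
  where "positive_op A \<longleftrightarrow> (\<forall>x. cinner x (A \<cdot> x) \<in> \<real>\<^sub>\<ge>\<^sub>0)"

definition abs_op :: "'a::complex_hilbert_space bop \<Rightarrow> 'a bop"
  where "abs_op A = (THE P. positive_op P \<and> P * P = adjoint_op A * A)"


section \<open>Trace class and density operators\<close>

text \<open>An orthonormal basis is a maximal orthonormal set, of any cardinality.\<close>

definition orthonormal_basis :: "'a::complex_hilbert_space set \<Rightarrow> bool"
  where "orthonormal_basis E \<longleftrightarrow>
    (\<forall>e\<in>E. norm e = 1) \<and> (\<forall>e\<in>E. \<forall>f\<in>E. e \<noteq> f \<longrightarrow> cinner e f = 0) \<and>
    (\<forall>x. (\<forall>e\<in>E. cinner e x = 0) \<longrightarrow> x = 0)"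

text \<open>For positive operators the sum below, and for trace-class operators its value, do not
  depend on the orthonormal basis, so a fixed one is chosen.\<close>

definition some_basis :: "'a::complex_hilbert_space set"
  where "some_basis = (SOME E. orthonormal_basis E)"

definition trace :: "'a::complex_hilbert_space bop \<Rightarrow> complex"
  where "trace A = (\<Sum>\<^sub>\<infinity>e\<in>some_basis. cinner e (A \<cdot> e))"

definition trace_class :: "'a::complex_hilbert_space bop set"
  where "trace_class = {A. (\<lambda>e. cinner e (abs_op A \<cdot> e)) summable_on some_basis}"

definition trace_norm :: "'a::complex_hilbert_space bop \<Rightarrow> real"
  where "trace_norm A = Re (trace (abs_op A))"

definition trace_norm_topology :: "'a::complex_hilbert_space bop topology"
  where "trace_norm_topology = Metric_space.mtopology trace_class (\<lambda>X Y. trace_norm (X - Y))"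

definition density_operators :: "'a::complex_hilbert_space bop set"
  where "density_operators = {\<rho> \<in> trace_class. positive_op \<rho> \<and> trace \<rho> = 1}"


section \<open>Quantum dynamical semigroups\<close>

text \<open>An \<open>n\<close> by \<open>n\<close> matrix of operators is positive if it is positive as an operator on the
  direct sum of \<open>n\<close> copies of the Hilbert space. Complete positivity of \<open>\<Phi>\<close> is positivity of
  all entrywise amplifications of \<open>\<Phi>\<close> to such matrices.\<close>

definition positive_op_matrix ::
    "nat \<Rightarrow> (nat \<Rightarrow> nat \<Rightarrow> 'a::complex_hilbert_space bop) \<Rightarrow> bool"
  where "positive_op_matrix n A \<longleftrightarrow>
    (\<forall>x. (\<Sum>i<n. \<Sum>j<n. cinner (x i) (A i j \<cdot> x j)) \<in> \<real>\<^sub>\<ge>\<^sub>0)"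

definition completely_positive :: "('a::complex_hilbert_space bop \<Rightarrow> 'a bop) \<Rightarrow> bool"
  where "completely_positive \<Phi> \<longleftrightarrow>
    (\<forall>n A. positive_op_matrix n A \<longrightarrow> positive_op_matrix n (\<lambda>i j. \<Phi> (A i j)))"

definition loewner_le :: "'a::complex_hilbert_space bop \<Rightarrow> 'a bop \<Rightarrow> bool"
  where "loewner_le A B \<longleftrightarrow> positive_op (B - A)"

definition loewner_lub :: "'a::complex_hilbert_space bop set \<Rightarrow> 'a bop \<Rightarrow> bool"
  where "loewner_lub D X \<longleftrightarrow>
    (\<forall>A\<in>D. loewner_le A X) \<and> (\<forall>Y. (\<forall>A\<in>D. loewner_le A Y) \<longrightarrow> loewner_le X Y)"

text \<open>Normality: suprema of increasing nets of positive operators are preserved. Up to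
  reindexing, an increasing net is an upward directed set.\<close>

definition normal_map :: "('a::complex_hilbert_space bop \<Rightarrow> 'a bop) \<Rightarrow> bool"
  where "normal_map \<Phi> \<longleftrightarrow>
    (\<forall>D X. D \<noteq> {} \<longrightarrow> (\<forall>A\<in>D. positive_op A) \<longrightarrow>
       (\<forall>A\<in>D. \<forall>B\<in>D. \<exists>C\<in>D. loewner_le A C \<and> loewner_le B C) \<longrightarrow>
       loewner_lub D X \<longrightarrow> loewner_lub (\<Phi> ` D) (\<Phi> X))"

text \<open>\<^typ>\<open>'a bop \<Rightarrow>\<^sub>L 'a bop\<close> carries the operator norm of maps on the algebra of bounded
  operators; complex homogeneity is required separately. Only times \<open>t \<ge> 0\<close> matter.\<close>

definition quantum_dynamical_semigroup ::
    "(real \<Rightarrow> 'a::complex_hilbert_space bop \<Rightarrow>\<^sub>L 'a bop) \<Rightarrow> bool"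
  where "quantum_dynamical_semigroup T \<longleftrightarrow>
    T 0 = id_blinfun \<and>
    (\<forall>s\<ge>0. \<forall>t\<ge>0. T (s + t) = T s o\<^sub>L T t) \<and>
    (\<forall>t\<ge>0. (\<forall>c A. T t (c *\<^sub>C A) = c *\<^sub>C T t A) \<and>
       completely_positive (T t) \<and> normal_map (T t))"

definition uniformly_continuous_semigroup ::
    "(real \<Rightarrow> 'a::complex_hilbert_space bop \<Rightarrow>\<^sub>L 'a bop) \<Rightarrow> bool"
  where "uniformly_continuous_semigroup T \<longleftrightarrow> (T \<longlongrightarrow> id_blinfun) (at_right 0)"

text \<open>The dual semigroup acts on the trace class by maps that are linear and bounded for the
  trace norm; its values outside the trace class are irrelevant.\<close>

definition dual_semigroup :: "(real \<Rightarrow> 'a::complex_hilbert_space bop \<Rightarrow>\<^sub>L 'a bop) \<Rightarrow>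
    (real \<Rightarrow> 'a bop \<Rightarrow> 'a bop) \<Rightarrow> bool"
  where "dual_semigroup T S \<longleftrightarrow>
    (\<forall>\<rho>\<in>trace_class. S 0 \<rho> = \<rho>) \<and>
    (\<forall>s\<ge>0. \<forall>t\<ge>0. \<forall>\<rho>\<in>trace_class. S (s + t) \<rho> = S s (S t \<rho>)) \<and>
    (\<forall>t\<ge>0. S t ` trace_class \<subseteq> trace_class \<and>
       (\<forall>\<rho>\<in>trace_class. \<forall>\<sigma>\<in>trace_class. S t (\<rho> + \<sigma>) = S t \<rho> + S t \<sigma>) \<and>
       (\<forall>c. \<forall>\<rho>\<in>trace_class. S t (c *\<^sub>C \<rho>) = c *\<^sub>C S t \<rho>) \<and>
       (\<exists>K. \<forall>\<rho>\<in>trace_class. trace_norm (S t \<rho>) \<le> K * trace_norm \<rho>) \<and>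
       S t ` density_operators \<subseteq> density_operators \<and>
       (\<forall>\<rho>\<in>density_operators. \<forall>X. trace (X * S t \<rho>) = trace (T t X * \<rho>)))"

text \<open>Convergence of \<open>S t\<close> to the identity, as \<open>t\<close> decreases to \<open>0\<close>, in the operator norm of
  bounded maps on the trace class.\<close>

definition uniformly_continuous_dual ::
    "(real \<Rightarrow> 'a::complex_hilbert_space bop \<Rightarrow> 'a bop) \<Rightarrow> bool"
  where "uniformly_continuous_dual S \<longleftrightarrow>
    (\<forall>\<epsilon>>0. \<forall>\<^sub>F t in at_right 0. \<forall>\<rho>\<in>trace_class.
       trace_norm (S t \<rho> - \<rho>) \<le> \<epsilon> * trace_norm \<rho>)"

definition invariant_densities ::
    "(real \<Rightarrow> 'a::complex_hilbert_space bop \<Rightarrow>\<^sub>L 'a bop) \<Rightarrow> 'a bop set"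
  where "invariant_densities T =
    {\<rho> \<in> density_operators. \<forall>A. \<forall>t\<ge>0. trace (\<rho> * T t A) = trace (\<rho> * A)}"

end

theory Submission
  imports Defs
begin

text \<open>Positivity, the normalisation \<open>tr \<rho> = 1\<close> and each invariance equation survive convex combinations
  and trace-norm limits, because \<open>\<rho> \<mapsto> tr (\<rho> A)\<close> is linear on the trace class with
  \<open>\<bar>tr (\<rho> A)\<bar> \<le> \<parallel>A\<parallel> \<parallel>\<rho>\<parallel>\<^sub>1\<close>, and the operator norm is at most the trace norm. This bound comes from
  the polar decomposition: \<open>Z\<close> factors through the square root of \<open>\<bar>Z\<bar>\<close>, whose squared Hilbert-Schmidt
  norm is \<open>\<parallel>Z\<parallel>\<^sub>1\<close>, and the Cauchy-Schwarz inequality applies to the diagonal of \<open>B Z A\<close>.\<close>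

section \<open>Inner products and bounded operators\<close>

text \<open>The notions are descriptions: \<open>adjoint_op\<close> and \<open>abs_op\<close> use
  \<open>THE\<close>, \<open>some_basis\<close> uses \<open>SOME\<close>, and \<open>infsum\<close>
  has a default value where it diverges. Existence, uniqueness and summability must therefore
  precede any estimate. The main obstacle is that \<open>abs_op (X + Y)\<close> is not determined by
  \<open>abs_op X\<close> and \<open>abs_op Y\<close>. The polar contraction \<open>W\<close>
  removes it: \<open>W * A = abs_op A\<close> turns an absolute value into a product that is linear
  once \<open>W\<close> is fixed, while \<open>adjoint_op W * abs_op A = A\<close> recovers the
  operator. Riesz representation is stated for subspaces that need not be closed because it serves
  three purposes: adjoints (the whole space), the polar contraction (a range) and the density of
  finite basis expansions behind Parseval's identity. All traces are taken in the one chosen basis,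
  where Parseval lets Hilbert-Schmidt bounds pass to adjoints.\<close>

lemma cinner_add_left: "cinner (x + y) z = cinner x z + cinner (y :: 'a::complex_hilbert_space) z"
  by (metis cinner_add_right cinner_commute complex_cnj_add)

lemma cinner_scaleC_left: "cinner (c *\<^sub>C x) z = cnj c * cinner (x :: 'a::complex_hilbert_space) z"
  by (metis cinner_commute cinner_scaleC_right complex_cnj_mult)

lemma cinner_scaleR_left: "cinner (r *\<^sub>R x) z = of_real r * cinner (x :: 'a::complex_hilbert_space) z"
  by (simp add: scaleR_scaleC cinner_scaleC_left)

lemma cinner_scaleR_right: "cinner x (r *\<^sub>R z) = of_real r * cinner (x :: 'a::complex_hilbert_space) z"
  by (simp add: scaleR_scaleC cinner_scaleC_right)

lemma cinner_zero [simp]: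
  "cinner 0 x = 0" "cinner (x :: 'a::complex_hilbert_space) 0 = 0"
  using cinner_scaleR_left[of 0 0 x] cinner_scaleR_right[of x 0 0] by auto

lemma cinner_minus [simp]:
  "cinner (- x) y = - cinner x y" "cinner x (- y) = - cinner (x :: 'a::complex_hilbert_space) y"
  using cinner_scaleR_left[of "-1" x y] cinner_scaleR_right[of x "-1" y] by auto

lemma cinner_diff_left: "cinner (x - y) z = cinner x z - cinner (y :: 'a::complex_hilbert_space) z"
  using cinner_add_left[of x "- y" z] by simp

lemma cinner_diff_right: "cinner z (x - y) = cinner z x - cinner z (y :: 'a::complex_hilbert_space)"
  using cinner_add_right[of z x "- y"] by simp

lemmas cinner_simps = cinner_add_left cinner_add_right cinner_diff_left cinner_diff_right
  cinner_scaleC_left cinner_scaleC_right cinner_scaleR_left cinner_scaleR_right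

lemma cinner_sum_left: "cinner (\<Sum>i\<in>A. f i) y = (\<Sum>i\<in>A. cinner (f i) (y :: 'a::complex_hilbert_space))"
  by (induction A rule: infinite_finite_induct) (auto simp: cinner_simps)

lemma cinner_sum_right: "cinner y (\<Sum>i\<in>A. f i) = (\<Sum>i\<in>A. cinner (y :: 'a::complex_hilbert_space) (f i))"
  by (induction A rule: infinite_finite_induct) (auto simp: cinner_simps)

lemma power2_norm_eq_cinner: "(norm (x :: 'a::complex_hilbert_space))\<^sup>2 = Re (cinner x x)"
  by (simp add: cinner_self)

lemma cinner_self_eq_0: "cinner x x = 0 \<longleftrightarrow> (x :: 'a::complex_hilbert_space) = 0"
  by (simp add: cinner_self)

lemma cinner_eqI:
  fixes x y :: "'a::complex_hilbert_space"
  assumes "\<And>z. cinner z x = cinner z y"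
  shows "x = y"
  by (metis assms cinner_diff_right cinner_self_eq_0 eq_iff_diff_eq_0)

lemma scaleC_1: "1 *\<^sub>C x = (x :: 'a::complex_hilbert_space)"
  using scaleR_scaleC[of 1 x] by simp

lemma bop_apply_minus [simp]: "(- A) \<cdot> x = - (A \<cdot> x)"
  using bop_apply_simps(4)[of 0 A x] by (simp add: bop_apply_simps)

lemma bop_apply_0 [simp]: "A \<cdot> 0 = 0"
  using bop_apply_simps(8)[of A 0 0] by simp

lemma bop_apply_diff: "A \<cdot> (x - y) = A \<cdot> x - A \<cdot> y"
  by (metis bop_apply_simps(8) add_diff_cancel diff_add_cancel)

lemma bop_apply_scaleR: "A \<cdot> (r *\<^sub>R x) = r *\<^sub>R A \<cdot> x"
  by (simp add: scaleR_scaleC bop_apply_simps)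

lemma bop_eqI: "(\<And>x. A \<cdot> x = B \<cdot> x) \<Longrightarrow> A = B"
  by transfer (rule blinfun_eqI)

lemma norm_bop_apply: "norm (A \<cdot> x) \<le> norm A * norm x"
  by transfer (rule norm_blinfun)

lemma norm_bop_bound: "0 \<le> b \<Longrightarrow> (\<And>x. norm (A \<cdot> x) \<le> b * norm x) \<Longrightarrow> norm A \<le> b"
  by transfer (rule norm_blinfun_bound)

section \<open>Positive operators and Cauchy-Schwarz inequalities\<close>

lemma positive_opD:
  assumes "positive_op A"
  shows "cinner x (A \<cdot> x) = of_real (Re (cinner x (A \<cdot> x)))" "0 \<le> Re (cinner x (A \<cdot> x))"
  using assms by (auto simp: positive_op_def complex_nonneg_Reals_iff complex_eq_iff)

text \<open>Polarisation: reality of the quadratic form at \<open>x + y\<close> settles the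
  imaginary parts of the mixed terms, and at \<open>x + \<i> *\<^sub>C y\<close> their real
  parts.\<close>

lemma positive_op_hermitian:
  fixes A :: "'a::complex_hilbert_space bop"
  assumes "positive_op A"
  shows "cinner (A \<cdot> x) y = cinner x (A \<cdot> y)"
proof -
  have im: "Im (cinner z (A \<cdot> z)) = 0" for z
    using assms by (auto simp: positive_op_def complex_nonneg_Reals_iff)
  have "Im (cinner x (A \<cdot> y)) + Im (cinner y (A \<cdot> x)) = 0"
    using im[of "x + y"] im[of x] im[of y] by (simp add: bop_apply_simps cinner_simps)
  moreover have "Re (cinner x (A \<cdot> y)) - Re (cinner y (A \<cdot> x)) = 0"
    using im[of "x + \<i> *\<^sub>C y"] im[of x] im[of y] by (simp add: bop_apply_simps cinner_simps)
  ultimately have "cinner x (A \<cdot> y) = cnj (cinner y (A \<cdot> x))"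
    by (simp add: complex_eq_iff)
  then show ?thesis
    by (simp flip: cinner_commute)
qed

lemma positive_op_Cauchy_Schwarz:
  fixes A :: "'a::complex_hilbert_space bop"
  assumes "positive_op A"
  shows "(cmod (cinner x (A \<cdot> y)))\<^sup>2 \<le> Re (cinner x (A \<cdot> x)) * Re (cinner y (A \<cdot> y))"
proof -
  define a b z where "a = Re (cinner x (A \<cdot> x))" and "b = Re (cinner y (A \<cdot> y))"
    and "z = cinner x (A \<cdot> y)"
  have nn: "0 \<le> a" "0 \<le> b"
    using positive_opD(2)[OF assms] by (auto simp: a_def b_def)
  have z': "cinner y (A \<cdot> x) = cnj z"
    unfolding z_def using positive_op_hermitian[OF assms, of y x] cinner_commute by metis
  have q: "0 \<le> a - 2 * t * (cmod z)\<^sup>2 + t\<^sup>2 * (cmod z)\<^sup>2 * b" for t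
  proof -
    \<comment> \<open>The factor \<open>cnj z\<close> cancels the phase of the mixed term, so a real
      quadratic in \<open>t\<close> remains.\<close>
    define c where "c = - of_real t * cnj z"
    have "0 \<le> Re (cinner (x + c *\<^sub>C y) (A \<cdot> (x + c *\<^sub>C y)))"
      by (rule positive_opD(2)[OF assms])
    also have "cinner (x + c *\<^sub>C y) (A \<cdot> (x + c *\<^sub>C y))
        = cinner x (A \<cdot> x) + c * z + cnj c * cnj z + (cnj c * c) * cinner y (A \<cdot> y)"
      using z' by (simp add: bop_apply_simps cinner_simps z_def algebra_simps)
    also have "Re \<dots> = a + 2 * Re (c * z) + (cmod c)\<^sup>2 * b"
      unfolding cmod_power2 by (simp add: a_def b_def power2_eq_square)
    also have "Re (c * z) = - t * (cmod z)\<^sup>2"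
      unfolding cmod_power2 by (simp add: c_def power2_eq_square algebra_simps)
    also have "(cmod c)\<^sup>2 = t\<^sup>2 * (cmod z)\<^sup>2"
      by (simp add: c_def norm_mult power_mult_distrib)
    finally show ?thesis by simp
  qed
  have "(cmod z)\<^sup>2 \<le> a * b"
  proof (cases "b = 0")
    case True
    \<comment> \<open>The form may be degenerate. For \<open>b = 0\<close> the quadratic is affine
      in \<open>t\<close>, and the chosen \<open>t\<close> gives it the value
      \<open>- a - 2\<close>; otherwise the minimiser \<open>1 / b\<close> is used.\<close>
    have "(cmod z)\<^sup>2 = 0"
    proof (rule ccontr)
      assume "(cmod z)\<^sup>2 \<noteq> 0"
      then show False
        using q[of "(a + 1) / (cmod z)\<^sup>2"] True nn by simp
    qed
    then show ?thesis using True by simp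
  next
    case False
    then have "b > 0" using nn by simp
    then show ?thesis
      using q[of "1 / b"] by (simp add: field_simps power2_eq_square)
  qed
  then show ?thesis by (simp add: a_def b_def z_def)
qed

lemma positive_op_1: "positive_op (1 :: 'a::complex_hilbert_space bop)"
  by (simp add: positive_op_def bop_apply_simps cinner_self flip: of_real_power)

lemma cinner_Cauchy_Schwarz: "cmod (cinner x y) \<le> norm x * norm (y :: 'a::complex_hilbert_space)"
  using positive_op_Cauchy_Schwarz[OF positive_op_1, of x y]
  by (simp add: bop_apply_simps flip: power2_norm_eq_cinner power_mult_distrib)

lemma bounded_bilinear_cinner:
  "bounded_bilinear (cinner :: 'a::complex_hilbert_space \<Rightarrow> 'a \<Rightarrow> complex)"
proof
  show "\<exists>K. \<forall>a b. cmod (cinner a b) \<le> norm (a :: 'a) * norm b * K"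
    by (rule exI[of _ 1]) (simp add: cinner_Cauchy_Schwarz)
qed (simp_all add: cinner_simps scaleR_conv_of_real)

lemmas tendsto_cinner [tendsto_intros] = bounded_bilinear.tendsto[OF bounded_bilinear_cinner]

lemma cmod_cinner_bop_le:
  "cmod (cinner x (A \<cdot> y)) \<le> norm A * norm x * norm (y :: 'a::complex_hilbert_space)"
proof -
  have "cmod (cinner x (A \<cdot> y)) \<le> norm x * (norm A * norm y)"
    by (rule order_trans[OF cinner_Cauchy_Schwarz mult_left_mono[OF norm_bop_apply]]) simp
  then show ?thesis by (simp add: mult_ac)
qed

lemma norm_bop_le_cinner:
  fixes A :: "'a::complex_hilbert_space bop"
  assumes "0 \<le> b" and le: "\<And>x y. cmod (cinner x (A \<cdot> y)) \<le> b * norm x * norm y"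
  shows "norm A \<le> b"
proof (rule norm_bop_bound[OF assms(1)])
  fix y
  show "norm (A \<cdot> y) \<le> b * norm y"
  proof (cases "A \<cdot> y = 0")
    case False
    have "norm (A \<cdot> y) * norm (A \<cdot> y) \<le> norm (A \<cdot> y) * (b * norm y)"
      using le[of "A \<cdot> y" y] by (simp add: cinner_self norm_mult power2_eq_square mult_ac)
    then show ?thesis using False by simp
  qed (use assms(1) in simp)
qed

lemma bounded_bilinear_bop_apply:
  "bounded_bilinear (bop_apply :: 'a::complex_hilbert_space bop \<Rightarrow> 'a \<Rightarrow> 'a)"
proof
  show "\<exists>K. \<forall>a b. norm (a \<cdot> b) \<le> norm (a :: 'a bop) * norm b * K"
    by (rule exI[of _ 1]) (simp add: norm_bop_apply)
qed (simp_all add: bop_apply_simps bop_apply_scaleR)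

lemmas tendsto_bop_apply [tendsto_intros] = bounded_bilinear.tendsto[OF bounded_bilinear_bop_apply]

lemma bop_existsI:
  fixes g :: "'a::complex_hilbert_space \<Rightarrow> 'a"
  assumes add: "\<And>x y. g (x + y) = g x + g y" and scale: "\<And>c x. g (c *\<^sub>C x) = c *\<^sub>C g x"
    and bound: "\<And>x. norm (g x) \<le> K * norm x"
  shows "\<exists>B. \<forall>x. B \<cdot> x = g x"
proof -
  have bl: "bounded_linear g"
    by (rule bounded_linear_intro[where K = K])
      (simp_all add: add scale bound scaleR_scaleC mult.commute)
  have "bop_apply (Bop (Blinfun g)) x = g x" for x
    unfolding bop_apply.rep_eq
    by (subst Bop_inverse) (simp_all add: bounded_linear_Blinfun_apply[OF bl] scale)
  then show ?thesis by blast
qed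

text \<open>Completeness supplies the limit of the square root iteration. The limit exists among
  real-linear operators, and complex homogeneity survives because it is a pointwise closed
  condition.\<close>

instance bop :: (complex_hilbert_space) banach
proof
  fix X :: "nat \<Rightarrow> 'a bop"
  assume "Cauchy X"
  then have "Cauchy (\<lambda>n. bop_blinfun (X n))"
    by (simp add: Cauchy_def dist_norm norm_bop.rep_eq minus_bop.rep_eq)
  then obtain L where L: "(\<lambda>n. bop_blinfun (X n)) \<longlonglongrightarrow> L"
    using Cauchy_convergent convergent_def by blast
  have pt: "(\<lambda>n. X n \<cdot> x) \<longlonglongrightarrow> blinfun_apply L x" for x
    unfolding bop_apply.rep_eq by (intro tendsto_intros L)
  have "blinfun_apply L (c *\<^sub>C x) = c *\<^sub>C blinfun_apply L x" for c x
  proof (rule LIMSEQ_unique[OF pt])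
    show "(\<lambda>n. X n \<cdot> (c *\<^sub>C x)) \<longlonglongrightarrow> c *\<^sub>C blinfun_apply L x"
      unfolding bop_apply_simps by (rule bounded_linear.tendsto[OF bounded_linear_scaleC pt])
  qed
  then have "bop_blinfun (Bop L) = L"
    by (simp add: Bop_inverse)
  then have "X \<longlonglongrightarrow> Bop L"
    using L by (simp add: LIMSEQ_iff norm_bop.rep_eq minus_bop.rep_eq)
  then show "convergent X" by (auto simp: convergent_def)
qed

text \<open>The representing vector is found as the limit of a minimising sequence of
  \<open>\<parallel>v\<parallel>\<^sup>2 - 2 Re f(v)\<close> over \<open>V\<close>, which is Cauchy by the parallelogram law.\<close>

lemma Riesz_subspace:
  fixes V :: "'a::complex_hilbert_space set" and f :: "'a \<Rightarrow> complex"
  assumes "0 \<in> V" and add: "\<And>u v. u \<in> V \<Longrightarrow> v \<in> V \<Longrightarrow> u + v \<in> V"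
    and scale: "\<And>c v. v \<in> V \<Longrightarrow> c *\<^sub>C v \<in> V"
    and f_add: "\<And>u v. u \<in> V \<Longrightarrow> v \<in> V \<Longrightarrow> f (u + v) = f u + f v"
    and f_scale: "\<And>c v. v \<in> V \<Longrightarrow> f (c *\<^sub>C v) = c * f v"
    and f_le: "\<And>v. v \<in> V \<Longrightarrow> cmod (f v) \<le> C * norm v" and C: "0 \<le> C"
  obtains w where "w \<in> closure V" "\<And>v. v \<in> V \<Longrightarrow> f v = cinner w v" "norm w \<le> C"
proof -
  have scaleR: "v \<in> V \<Longrightarrow> r *\<^sub>R v \<in> V" and f_scaleR: "v \<in> V \<Longrightarrow> f (r *\<^sub>R v) = of_real r * f v" for r v
    by (simp_all add: scaleR_scaleC scale f_scale)
  define J where "J v = (norm v)\<^sup>2 - 2 * Re (f v)" for v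
  define m where "m = Inf (J ` V)"
  have J_ge: "- C\<^sup>2 \<le> J v" if "v \<in> V" for v
  proof -
    have "Re (f v) \<le> C * norm v"
      using f_le[OF that] complex_Re_le_cmod order_trans by blast
    moreover have "0 \<le> (norm v - C)\<^sup>2" by simp
    ultimately show ?thesis by (simp add: J_def power2_diff mult_ac)
  qed
  have m_le: "m \<le> J v" if "v \<in> V" for v
    unfolding m_def by (rule cInf_lower) (use J_ge that in \<open>auto intro!: bdd_belowI\<close>)
  have "\<exists>v\<in>V. J v < m + 1 / real (Suc n)" for n
  proof -
    have "Inf (J ` V) < m + 1 / real (Suc n)" by (simp add: m_def)
    then show ?thesis using cInf_lessD[of "J ` V"] \<open>0 \<in> V\<close> by blast
  qed
  then obtain v where vV: "\<And>n. v n \<in> V" and v_less: "\<And>n. J (v n) < m + 1 / real (Suc n)"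
    by metis
  \<comment> \<open>The midpoint lies in \<open>V\<close>, so \<open>J\<close> is at least
    \<open>m\<close> there; hence two nearly minimal vectors are close.\<close>
  have para: "(norm (x - y))\<^sup>2 \<le> 2 * (J x - m) + 2 * (J y - m)" if "x \<in> V" "y \<in> V" for x y
  proof -
    have "m \<le> J ((1/2) *\<^sub>R (x + y))"
      using that by (intro m_le scaleR add)
    also have "\<dots> = (norm (x + y))\<^sup>2 / 4 - (Re (f x) + Re (f y))"
      using that by (simp add: J_def f_scaleR add f_add power_divide power_mult_distrib add_divide_distrib del: scaleR_add_right)
    finally have "4 * m \<le> (norm (x + y))\<^sup>2 - 4 * (Re (f x) + Re (f y))" by simp
    moreover have "(norm (x - y))\<^sup>2 + (norm (x + y))\<^sup>2 = 2 * (norm x)\<^sup>2 + 2 * (norm y)\<^sup>2"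
      by (simp add: power2_norm_eq_cinner cinner_simps)
    ultimately show ?thesis
      unfolding J_def by argo
  qed
  have "Cauchy v"
  proof (rule CauchyI)
    fix e :: real assume e: "0 < e"
    obtain N where N: "4 / e\<^sup>2 < real N" using reals_Archimedean2 by blast
    have "norm (v k - v n) < e" if "k \<ge> N" "n \<ge> N" for k n
    proof -
      have N0: "0 < real N" using N e by (meson divide_pos_pos less_trans zero_less_numeral zero_less_power)
      have *: "J (v k) - m < 1 / real N" if "k \<ge> N" for k
      proof -
        have "1 / real (Suc k) \<le> 1 / real N"
          using that N0 by (intro divide_left_mono) auto
        then show ?thesis using v_less[of k] by linarith
      qed
      have "(norm (v k - v n))\<^sup>2 < 4 / real N"
        using para[OF vV vV, of k n] *[OF that(1)] *[OF that(2)] by simp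
      also have "\<dots> < e\<^sup>2" using N e N0 by (simp add: field_simps)
      finally show ?thesis using e by (simp add: power_less_imp_less_base)
    qed
    then show "\<exists>M. \<forall>k\<ge>M. \<forall>n\<ge>M. norm (v k - v n) < e" by blast
  qed
  then obtain w where w: "v \<longlonglongrightarrow> w"
    using Cauchy_convergent convergent_def by blast
  have Jlim: "(\<lambda>n. J (v n)) \<longlonglongrightarrow> m"
  proof (rule tendsto_sandwich[of "\<lambda>_. m" _ _ "\<lambda>n. m + 1 / real (Suc n)"])
    show "(\<lambda>n. m + 1 / real (Suc n)) \<longlonglongrightarrow> m"
      using tendsto_add[OF tendsto_const LIMSEQ_Suc[OF lim_1_over_n], of m] by simp
    show "(\<lambda>_. m) \<longlonglongrightarrow> m" by simp
  qed (use m_le[OF vV] less_imp_le[OF v_less] in \<open>auto intro!: always_eventually\<close>)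
  \<comment> \<open>First variation at the minimum. Since \<open>w\<close> may lie outside
    \<open>V\<close>, where neither \<open>f\<close> nor the bound by \<open>m\<close> is
    controlled, the inequality is written at \<open>v n\<close> and passed to the limit.\<close>
  have Re_eq: "Re (f u) = Re (cinner w u)" if u: "u \<in> V" for u
  proof -
    define d where "d = Re (cinner w u) - Re (f u)"
    have q: "0 \<le> 2 * t * d + t\<^sup>2 * (norm u)\<^sup>2" for t
    proof -
      have "m \<le> J (v n) + (2 * t * (Re (cinner (v n) u) - Re (f u)) + t\<^sup>2 * (norm u)\<^sup>2)" for n
      proof -
        have "Re (cinner u (v n)) = Re (cinner (v n) u)"
          by (subst cinner_commute) simp
        then have "(norm (v n + t *\<^sub>R u))\<^sup>2
            = (norm (v n))\<^sup>2 + 2 * t * Re (cinner (v n) u) + t\<^sup>2 * (norm u)\<^sup>2"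
          by (simp add: power2_norm_eq_cinner cinner_simps algebra_simps power2_eq_square[of t])
        moreover have "m \<le> J (v n + t *\<^sub>R u)" by (intro m_le add vV scaleR u)
        ultimately show ?thesis
          using u vV by (simp add: J_def f_add scaleR f_scaleR algebra_simps)
      qed
      moreover have "(\<lambda>n. J (v n) + (2 * t * (Re (cinner (v n) u) - Re (f u)) + t\<^sup>2 * (norm u)\<^sup>2))
          \<longlonglongrightarrow> m + (2 * t * d + t\<^sup>2 * (norm u)\<^sup>2)"
        unfolding d_def by (intro tendsto_intros Jlim w)
      ultimately have "m \<le> m + (2 * t * d + t\<^sup>2 * (norm u)\<^sup>2)"
        by (intro LIMSEQ_le_const) auto
      then show ?thesis by simp
    qed
    \<comment> \<open>A nonzero linear coefficient would make the quadratic negative near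
      \<open>t = 0\<close>; the value \<open>- d / (norm u)\<^sup>2\<close> is its
      minimiser.\<close>
    have "d = 0"
    proof (cases "norm u = 0")
      case True
      then show ?thesis using q[of "- d"] by (simp add: mult_less_0_iff not_less flip: power2_eq_square)
    next
      case False
      then show ?thesis using q[of "- d / (norm u)\<^sup>2"]
        by (simp add: field_simps power2_eq_square) (smt (verit) mult_eq_0_iff zero_le_mult_iff not_sum_squares_lt_zero)
    qed
    then show ?thesis by (simp add: d_def)
  qed
  \<comment> \<open>Applying the real identity to \<open>- \<i> *\<^sub>C u\<close> yields the
    imaginary parts.\<close>
  have f_eq: "f u = cinner w u" if u: "u \<in> V" for u
  proof (rule complex_eqI[OF Re_eq[OF u]])
    show "Im (f u) = Im (cinner w u)"
      using Re_eq[OF scale[OF u, of "- \<i>"]] by (simp add: f_scale u cinner_simps)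
  qed
  have "w \<in> closure V"
    using w vV closure_sequential by blast
  moreover have "norm w \<le> C"
  proof -
    have "cmod (cinner w (v n)) \<le> C * norm (v n)" for n
      using f_le[OF vV] f_eq[OF vV] by simp
    moreover have "(\<lambda>n. cmod (cinner w (v n))) \<longlonglongrightarrow> cmod (cinner w w)"
      "(\<lambda>n. C * norm (v n)) \<longlonglongrightarrow> C * norm w"
      by (intro tendsto_intros w)+
    ultimately have "cmod (cinner w w) \<le> C * norm w"
      by (intro LIMSEQ_le[of _ _ "\<lambda>n. C * norm (v n)"]) auto
    then have "norm w * norm w \<le> C * norm w"
      by (simp add: cinner_self norm_mult power2_eq_square)
    then show ?thesis
      using C by (cases "w = 0") auto
  qed
  ultimately show ?thesis using that f_eq by blast
qed

section \<open>Adjoints, square roots and polar decomposition\<close>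

text \<open>Riesz on the whole space yields one representing vector \<open>g x\<close> for each
  \<open>x\<close>. A vector is determined by its inner products, which makes \<open>g\<close>
  linear and the operator unique, so that the description in \<open>adjoint_op\<close> has its
  intended value.\<close>

lemma adjoint_op_left: "cinner (adjoint_op A \<cdot> x) y = cinner x (A \<cdot> (y :: 'a::complex_hilbert_space))"
proof -
  have "\<exists>w. (\<forall>y. cinner x (A \<cdot> y) = cinner w y) \<and> norm w \<le> norm A * norm x" for x :: 'a
  proof -
    obtain w where "\<And>v. v \<in> UNIV \<Longrightarrow> cinner x (A \<cdot> v) = cinner w v"
      "norm w \<le> norm A * norm x"
    proof (rule Riesz_subspace[of UNIV "\<lambda>v. cinner x (A \<cdot> v)" "norm A * norm x"])
      show "cmod (cinner x (A \<cdot> v)) \<le> norm A * norm x * norm v" for v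
        by (rule cmod_cinner_bop_le)
    qed (simp_all add: bop_apply_simps cinner_simps)
    then show ?thesis by auto
  qed
  then obtain g where g: "\<And>x y. cinner x (A \<cdot> y) = cinner (g x) y"
    and gb: "\<And>x. norm (g x) \<le> norm A * norm x"
    by metis
  have g_right: "cinner y (g x) = cinner (A \<cdot> y) x" for x y
    by (metis g cinner_commute)
  have "\<exists>B. \<forall>x. B \<cdot> x = g x"
  proof (rule bop_existsI[of g "norm A"])
    show "g (x + y) = g x + g y" for x y
      by (rule cinner_eqI) (simp add: g_right cinner_simps)
    show "g (c *\<^sub>C x) = c *\<^sub>C g x" for c x
      by (rule cinner_eqI) (simp add: g_right cinner_simps)
    show "norm (g x) \<le> norm A * norm x" for x
      using gb[of x] by auto
  qed
  then obtain B where B: "\<And>x. B \<cdot> x = g x" by blast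
  have "\<forall>x y. cinner (adjoint_op A \<cdot> x) y = cinner x (A \<cdot> y)"
    unfolding adjoint_op_def
  proof (rule theI[of _ B])
    show "C = B" if "\<forall>x y. cinner (C \<cdot> x) y = cinner x (A \<cdot> y)" for C
    proof (rule bop_eqI, rule cinner_eqI)
      show "cinner z (C \<cdot> x) = cinner z (B \<cdot> x)" for x z
        by (metis that B g cinner_commute)
    qed
  qed (simp add: B g)
  then show ?thesis by blast
qed

lemma adjoint_op_right: "cinner x (adjoint_op A \<cdot> y) = cinner (A \<cdot> x) (y :: 'a::complex_hilbert_space)"
  by (metis adjoint_op_left cinner_commute)

lemma adjoint_op_adjoint_op [simp]: "adjoint_op (adjoint_op A) = A"
  by (rule bop_eqI, rule cinner_eqI) (simp add: adjoint_op_right adjoint_op_left)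

lemma adjoint_op_uminus: "adjoint_op (- A) = - adjoint_op A"
  by (rule bop_eqI, rule cinner_eqI) (simp add: adjoint_op_right)

lemma adjoint_op_times: "adjoint_op (A * B) = adjoint_op B * adjoint_op A"
  by (rule bop_eqI, rule cinner_eqI) (simp add: adjoint_op_right bop_apply_simps)

lemma adjoint_op_positive: "positive_op A \<Longrightarrow> adjoint_op A = A"
  by (rule bop_eqI, rule cinner_eqI) (simp add: adjoint_op_right positive_op_hermitian)

lemma norm_adjoint_op [simp]: "norm (adjoint_op A) = norm A"
proof -
  have le: "norm (adjoint_op A) \<le> norm A" for A :: "'a bop"
  proof (rule norm_bop_le_cinner)
    show "cmod (cinner x (adjoint_op A \<cdot> y)) \<le> norm A * norm x * norm y" for x y
      using cmod_cinner_bop_le[of y A x]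
      by (simp add: adjoint_op_right mult_ac cinner_commute[of _ y])
  qed simp
  show ?thesis
    using le[of A] le[of "adjoint_op A"] by simp
qed

section \<open>Positivity of sums and of differences from the identity\<close>

lemma positive_op_scaleR: "0 \<le> r \<Longrightarrow> positive_op A \<Longrightarrow> positive_op (r *\<^sub>R A)"
  by (simp add: positive_op_def bop_apply_simps cinner_simps complex_nonneg_Reals_iff)

lemma positive_op_add: "positive_op A \<Longrightarrow> positive_op B \<Longrightarrow> positive_op (A + B)"
  by (simp add: positive_op_def bop_apply_simps cinner_simps complex_nonneg_Reals_iff)

lemma positive_op_adjoint_times: "positive_op (adjoint_op A * A)"
  by (simp add: positive_op_def bop_apply_simps adjoint_op_right cinner_self flip: of_real_power)

text \<open>Only an inequality holds in general: on the zero space the identity has norm 0.\<close>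

lemma norm_1_bop_le: "norm (1 :: 'a::complex_hilbert_space bop) \<le> 1"
  by (rule norm_bop_bound) (simp_all add: bop_apply_simps)

lemma hermitian_contraction_positive:
  fixes A :: "'a::complex_hilbert_space bop"
  assumes "adjoint_op A = A" "norm A \<le> 1"
  shows "positive_op (1 - A)"
proof -
  have "Im (cinner x (A \<cdot> x)) = 0" for x
    by (metis adjoint_op_left assms(1) cinner_commute complex_In_mult_cnj_zero
        add.inverse_inverse cnj.simps(2) eq_neg_iff_add_eq_0 double_eq_0_iff)
  moreover have "Re (cinner x (A \<cdot> x)) \<le> (norm x)\<^sup>2" for x
  proof -
    have "Re (cinner x (A \<cdot> x)) \<le> norm A * norm x * norm x"
      using cmod_cinner_bop_le complex_Re_le_cmod order_trans by blast
    also have "\<dots> \<le> 1 * norm x * norm x"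
      using assms(2) by (intro mult_right_mono) auto
    finally show ?thesis by (simp add: power2_eq_square)
  qed
  ultimately show ?thesis
    by (simp add: positive_op_def bop_apply_simps cinner_simps cinner_self complex_nonneg_Reals_iff
        flip: of_real_power)
qed

text \<open>The form of \<open>1 - A\<close> lies between 0 and that of the identity; Cauchy-Schwarz
  for this positive form extends the diagonal bound to all entries.\<close>

lemma norm_one_minus_positive_le:
  fixes A :: "'a::complex_hilbert_space bop"
  assumes "positive_op A" "norm A \<le> 1"
  shows "norm (1 - A) \<le> 1"
proof (rule norm_bop_le_cinner)
  fix x y :: 'a
  define B where "B = 1 - A"
  have B: "positive_op B"
    unfolding B_def using assms by (intro hermitian_contraction_positive adjoint_op_positive)
  have le: "Re (cinner x (B \<cdot> x)) \<le> (norm x)\<^sup>2" for x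
    using positive_opD(2)[OF assms(1), of x]
    by (simp add: B_def bop_apply_simps cinner_simps cinner_self)
  have "(cmod (cinner x (B \<cdot> y)))\<^sup>2 \<le> Re (cinner x (B \<cdot> x)) * Re (cinner y (B \<cdot> y))"
    by (rule positive_op_Cauchy_Schwarz[OF B])
  also have "\<dots> \<le> (norm x)\<^sup>2 * (norm y)\<^sup>2"
    by (intro mult_mono le positive_opD(2)[OF B]) auto
  finally show "cmod (cinner x ((1 - A) \<cdot> y)) \<le> 1 * norm x * norm y"
    unfolding B_def by (simp flip: power_mult_distrib)
qed simp

lemma positive_op_0: "positive_op 0"
  by (simp add: positive_op_def bop_apply_simps)

text \<open>With \<open>B = 1 - A\<close>, the iterates of \<open>X \<mapsto> (B + X\<^sup>2) / 2\<close> from \<open>0\<close> converge in norm to a fixed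
  point, whose distance from \<open>1\<close> is the square root of \<open>A\<close>: increments are dominated by those of the
  scalar iteration for \<open>B = 1\<close>, which increases to \<open>1\<close>.\<close>

lemma positive_sqrt_contraction:
  fixes A :: "'a::complex_hilbert_space bop"
  assumes A: "positive_op A" "norm A \<le> 1"
  obtains R where "positive_op R" "R * R = A" "\<And>C. C * A = A * C \<Longrightarrow> C * R = R * C"
proof -
  define B where "B = 1 - A"
  have nB: "norm B \<le> 1" and aB: "adjoint_op B = B"
    using norm_one_minus_positive_le[OF A] hermitian_contraction_positive[OF adjoint_op_positive A(2)] A(1)
    by (auto simp: B_def adjoint_op_positive)
  define X where "X = rec_nat 0 (\<lambda>_ X. (1/2) *\<^sub>R (B + X * X))"
  define s where "s = rec_nat 0 (\<lambda>_ x. (1/2) * (1 + x * x :: real))"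
  have X0: "X 0 = 0" and XS: "X (Suc n) = (1/2) *\<^sub>R (B + X n * X n)" for n
    by (simp_all add: X_def)
  have s0: "s 0 = 0" and sS: "s (Suc n) = (1/2) * (1 + s n * s n)" for n
    by (simp_all add: s_def)
  have s01: "0 \<le> s n \<and> s n \<le> 1" for n
    by (induction n) (auto simp: s0 sS intro: mult_le_one)
  have nX: "norm (X n) \<le> s n" for n
  proof (induction n)
    case (Suc n)
    have "norm (X n * X n) \<le> s n * s n"
      using norm_mult_ineq[of "X n" "X n"] mult_mono[OF Suc Suc] s01[of n] by force
    then show ?case
      using norm_triangle_ineq[of B "X n * X n"] nB by (simp add: XS sS)
  qed (simp add: X0 s0)
  have dX: "norm (X (Suc n) - X n) \<le> s (Suc n) - s n" for n
  proof (induction n)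
    case 0
    then show ?case using nB by (simp add: X0 XS s0 sS)
  next
    case (Suc n)
    define D where "D = X (Suc n) - X n"
    have D: "norm D \<le> s (Suc n) - s n" using Suc by (simp add: D_def)
    then have D0: "0 \<le> s (Suc n) - s n" using norm_ge_zero order_trans by blast
    \<comment> \<open>This splitting of a difference of squares is valid without
      commutativity.\<close>
    have "X (Suc (Suc n)) - X (Suc n) = (1/2) *\<^sub>R (D * X (Suc n) + X n * D)"
      by (simp only: XS[of "Suc n"] XS[of n] D_def) (simp add: algebra_simps XS[symmetric])
    moreover have "norm (D * X (Suc n)) \<le> (s (Suc n) - s n) * s (Suc n)"
      by (rule order_trans[OF norm_mult_ineq mult_mono[OF D nX D0]]) simp
    moreover have "norm (X n * D) \<le> s n * (s (Suc n) - s n)"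
      by (rule order_trans[OF norm_mult_ineq mult_mono[OF nX D]]) (use s01 in auto)
    ultimately have "norm (X (Suc (Suc n)) - X (Suc n))
        \<le> 1/2 * ((s (Suc n) - s n) * s (Suc n) + s n * (s (Suc n) - s n))"
      using norm_triangle_ineq[of "D * X (Suc n)" "X n * D"] by simp
    also have "\<dots> = 1/2 * (1 + s (Suc n) * s (Suc n)) - 1/2 * (1 + s n * s n)"
      by (simp add: algebra_simps)
    finally show ?case by (simp only: sS)
  qed
  have dX': "norm (X (n + k) - X n) \<le> s (n + k) - s n" for n k
  proof (induction k)
    case (Suc k)
    have "X (n + Suc k) - X n = (X (Suc (n + k)) - X (n + k)) + (X (n + k) - X n)" by simp
    then show ?case
      using norm_triangle_ineq[of "X (Suc (n + k)) - X (n + k)" "X (n + k) - X n"] dX[of "n + k"] Suc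
      by simp
  qed simp
  have "incseq s"
  proof (rule incseq_SucI)
    show "s n \<le> s (Suc n)" for n using dX[of n] norm_ge_zero[of "X (Suc n) - X n"] by linarith
  qed
  then obtain l where "s \<longlonglongrightarrow> l"
    using s01 incseq_convergent[of s 1] by blast
  then have "Cauchy s"
    by (rule LIMSEQ_imp_Cauchy)
  have "Cauchy X"
  proof (rule CauchyI')
    fix e :: real assume "0 < e"
    then obtain N where N: "\<And>m n. m \<ge> N \<Longrightarrow> n \<ge> N \<Longrightarrow> norm (s m - s n) < e"
      using CauchyD[OF \<open>Cauchy s\<close>] by blast
    have "norm (X m - X n) < e" if "m \<ge> N" "n > m" for m n
    proof -
      obtain k where "n = m + k" using \<open>n > m\<close> less_imp_add_positive by blast
      then show ?thesis
        using dX'[of m k] N[of n m] that by (simp add: norm_minus_commute)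
    qed
    then show "\<exists>M. \<forall>m\<ge>M. \<forall>n>m. dist (X m) (X n) < e" unfolding dist_norm by blast
  qed
  then obtain L where L: "X \<longlonglongrightarrow> L"
    using Cauchy_convergent convergent_def by blast
  have fixp: "L = (1/2) *\<^sub>R (B + L * L)"
  proof (rule LIMSEQ_unique[OF LIMSEQ_Suc[OF L]])
    show "(\<lambda>n. X (Suc n)) \<longlonglongrightarrow> (1/2) *\<^sub>R (B + L * L)"
      unfolding XS by (intro tendsto_intros L)
  qed
  \<comment> \<open>Doubling the fixed point equation gives \<open>L + L = B + L * L\<close>, which
    is \<open>(1 - L) * (1 - L) = 1 - B\<close> rearranged.\<close>
  have "L + L = (1/2 + 1/2) *\<^sub>R (B + L * L)"
    unfolding scaleR_add_left using fixp by simp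
  then have LL: "L + L = B + L * L" by simp
  have nL: "norm L \<le> 1"
    by (rule LIMSEQ_le_const2[OF tendsto_norm[OF L]]) (use nX s01 order_trans in blast)
  have aX: "adjoint_op (X n) = X n" for n
  proof (induction n)
    case 0
    show ?case by (simp add: X0 adjoint_op_positive positive_op_0)
  next
    case (Suc n)
    show ?case
    proof (rule bop_eqI, rule cinner_eqI)
      show "cinner z (adjoint_op (X (Suc n)) \<cdot> x) = cinner z (X (Suc n) \<cdot> x)" for x z
        using adjoint_op_left[of B] adjoint_op_left[of "X n"]
        by (simp add: adjoint_op_right XS bop_apply_simps cinner_simps Suc aB)
    qed
  qed
  have aL: "adjoint_op L = L"
  proof (rule bop_eqI, rule cinner_eqI)
    fix x z
    have "(\<lambda>n. cinner z (X n \<cdot> x)) \<longlonglongrightarrow> cinner z (L \<cdot> x)"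
      by (intro tendsto_intros L)
    moreover have "(\<lambda>n. cinner z (X n \<cdot> x)) = (\<lambda>n. cinner (X n \<cdot> z) x)"
      by (metis aX adjoint_op_right)
    then have "(\<lambda>n. cinner z (X n \<cdot> x)) \<longlonglongrightarrow> cinner (L \<cdot> z) x"
      by (simp only:) (intro tendsto_intros L)
    ultimately show "cinner z (adjoint_op L \<cdot> x) = cinner z (L \<cdot> x)"
      unfolding adjoint_op_right using LIMSEQ_unique by blast
  qed
  \<comment> \<open>The iterates are polynomials in \<open>B\<close>, so whatever commutes with
    \<open>A\<close> commutes with each of them and with the limit. Uniqueness of the root rests on
    this property.\<close>
  have "C * (1 - L) = (1 - L) * C" if CA: "C * A = A * C" for C
  proof -
    have CB: "C * B = B * C" using CA by (simp add: B_def algebra_simps)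
    have "C * X n = X n * C" for n
    proof (induction n)
      case (Suc n)
      have "C * (X n * X n) = (X n * X n) * C"
        by (metis Suc mult.assoc)
      then show ?case by (simp add: XS algebra_simps CB)
    qed (simp add: X0)
    moreover have "(\<lambda>n. C * X n) \<longlonglongrightarrow> C * L" "(\<lambda>n. X n * C) \<longlonglongrightarrow> L * C"
      by (intro tendsto_intros L)+
    ultimately have "C * L = L * C"
      using LIMSEQ_unique by simp
    then show ?thesis by (simp add: algebra_simps)
  qed
  moreover have "(1 - L) * (1 - L) = 1 - (L + L) + L * L"
    by (simp add: algebra_simps)
  then have "(1 - L) * (1 - L) = A"
    by (simp add: LL B_def)
  ultimately show ?thesis
    using hermitian_contraction_positive[OF aL nL] that by blast
qed

lemma positive_sqrt_commuting:
  fixes A :: "'a::complex_hilbert_space bop"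
  assumes "positive_op A"
  obtains R where "positive_op R" "R * R = A" "\<And>C. C * A = A * C \<Longrightarrow> C * R = R * C"
proof (cases "A = 0")
  case True
  then show ?thesis using that[of 0] positive_op_0 by simp
next
  case False
  define r where "r = norm A"
  have r: "r > 0" using False by (simp add: r_def)
  have "positive_op (inverse r *\<^sub>R A)" "norm (inverse r *\<^sub>R A) \<le> 1"
    using assms r by (auto simp: r_def intro: positive_op_scaleR)
  then obtain Q where Q: "positive_op Q" "Q * Q = inverse r *\<^sub>R A"
    and QC: "\<And>C. C * (inverse r *\<^sub>R A) = inverse r *\<^sub>R A * C \<Longrightarrow> C * Q = Q * C"
    using positive_sqrt_contraction by blast
  show ?thesis
  proof (rule that[of "sqrt r *\<^sub>R Q"])
    show "positive_op (sqrt r *\<^sub>R Q)" using Q r by (simp add: positive_op_scaleR)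
    show "sqrt r *\<^sub>R Q * sqrt r *\<^sub>R Q = A" using r by (simp add: Q(2) flip: mult.assoc)
    show "C * sqrt r *\<^sub>R Q = sqrt r *\<^sub>R Q * C" if "C * A = A * C" for C
      using QC[of C] that by simp
  qed
qed

text \<open>For commuting roots \<open>(P + Q) * (P - Q) = 0\<close>. With
  \<open>d = (P - Q) \<cdot> x\<close> the nonnegative values of both forms at \<open>d\<close> add
  up to 0, so Cauchy-Schwarz gives \<open>P \<cdot> d = Q \<cdot> d = 0\<close>, and then
  \<open>d\<close> is orthogonal to itself.\<close>

lemma positive_sqrt_unique_commuting:
  fixes P Q :: "'a::complex_hilbert_space bop"
  assumes P: "positive_op P" and Q: "positive_op Q" and PQ: "P * P = Q * Q" "P * Q = Q * P"
  shows "P = Q"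
proof (rule bop_eqI)
  fix x
  define d where "d = (P - Q) \<cdot> x"
  have "P \<cdot> d + Q \<cdot> d = 0"
  proof -
    have "P \<cdot> d + Q \<cdot> d = (P * P - Q * Q + (Q * P - P * Q)) \<cdot> x"
      by (simp add: d_def bop_apply_simps bop_apply_diff)
    then show ?thesis by (simp add: PQ bop_apply_simps)
  qed
  then have "cinner d (P \<cdot> d) + cinner d (Q \<cdot> d) = 0"
    by (simp flip: cinner_add_right)
  then have z: "Re (cinner d (P \<cdot> d)) = 0" "Re (cinner d (Q \<cdot> d)) = 0"
    using positive_opD(2)[OF P, of d] positive_opD(2)[OF Q, of d]
    by (simp_all add: complex_eq_iff add_nonneg_eq_0_iff)
  have "P \<cdot> d = 0" "Q \<cdot> d = 0"
    using positive_op_Cauchy_Schwarz[OF P, of "P \<cdot> d" d] positive_op_Cauchy_Schwarz[OF Q, of "Q \<cdot> d" d]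
    by (simp_all add: z cinner_self_eq_0)
  moreover have "cinner d y = cinner x (P \<cdot> y) - cinner x (Q \<cdot> y)" for y
    by (simp add: d_def bop_apply_simps cinner_simps positive_op_hermitian[OF P] positive_op_hermitian[OF Q])
  ultimately have "cinner d d = 0" by simp
  then show "P \<cdot> x = Q \<cdot> x"
    by (simp add: cinner_self_eq_0 d_def bop_apply_simps)
qed

text \<open>\<open>P\<close> and \<open>Q\<close> need not obviously commute with each other, but
  each commutes with the common square and hence with the constructed root \<open>R\<close>. Both
  therefore equal \<open>R\<close>.\<close>

lemma positive_sqrt_unique:
  fixes P Q :: "'a::complex_hilbert_space bop"
  assumes P: "positive_op P" and Q: "positive_op Q" and PQ: "P * P = Q * Q"
  shows "P = Q"
proof -
  have PP: "positive_op (P * P)"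
    using positive_op_adjoint_times[of P] by (simp add: adjoint_op_positive[OF P])
  obtain R where R: "positive_op R" "R * R = P * P"
    and RC: "\<And>C. C * (P * P) = (P * P) * C \<Longrightarrow> C * R = R * C"
    by (rule positive_sqrt_commuting[OF PP]) (rule that)
  have "P * R = R * P"
    by (rule RC) (simp add: mult.assoc)
  then have "P = R"
    by (rule positive_sqrt_unique_commuting[OF P R(1) R(2)[symmetric]])
  have "Q * R = R * Q"
    by (rule RC) (simp add: PQ mult.assoc)
  then have "Q = R"
    by (rule positive_sqrt_unique_commuting[OF Q R(1) trans[OF PQ[symmetric] R(2)[symmetric]]])
  with \<open>P = R\<close> show ?thesis by simp
qed

lemma abs_op:
  shows positive_abs_op: "positive_op (abs_op A)"
    and abs_op_square: "abs_op A * abs_op A = adjoint_op A * A"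
proof -
  obtain R where R: "positive_op R" "R * R = adjoint_op A * A"
    by (rule positive_sqrt_commuting[OF positive_op_adjoint_times[of A]]) (rule that)
  have "abs_op A = R"
    unfolding abs_op_def
  proof (rule the_equality)
    show "P = R" if "positive_op P \<and> P * P = adjoint_op A * A" for P
      by (rule positive_sqrt_unique) (use that R in simp_all)
  qed (simp add: R)
  then show "positive_op (abs_op A)" "abs_op A * abs_op A = adjoint_op A * A"
    using R by simp_all
qed

lemma abs_op_uminus: "abs_op (- A) = abs_op A"
  by (simp add: abs_op_def adjoint_op_uminus)

lemma abs_op_0 [simp]: "abs_op 0 = (0 :: 'a::complex_hilbert_space bop)"
  by (rule positive_sqrt_unique) (simp_all add: positive_abs_op positive_op_0 abs_op_square)

lemma cinner_abs_op: "cinner (abs_op A \<cdot> x) (abs_op A \<cdot> y) = cinner (A \<cdot> x) (A \<cdot> y)"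
  by (metis abs_op_square adjoint_op_right bop_apply_simps(5) positive_abs_op positive_op_hermitian)

text \<open>\<open>W\<close> is the adjoint of the partial isometry in the polar decomposition of \<open>A\<close>. Requiring
  \<open>W x\<close> to lie in the double orthogonal complement of the range of \<open>\<bar>A\<bar>\<close> makes it unique,
  hence linear in \<open>x\<close>.\<close>

lemma polar_contraction:
  fixes A :: "'a::complex_hilbert_space bop"
  obtains W where "norm W \<le> 1" "W * A = abs_op A" "adjoint_op W * abs_op A = A"
proof -
  define P where "P = abs_op A"
  have PA: "cinner (P \<cdot> x) (P \<cdot> y) = cinner (A \<cdot> x) (A \<cdot> y)" for x y
    by (simp add: P_def cinner_abs_op)
  have nPA: "norm (P \<cdot> x) = norm (A \<cdot> x)" for x
    using PA[of x x] by (simp add: cinner_self flip: of_real_power)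
  define V where "V = range (bop_apply P)"
  \<comment> \<open>This is the closure of \<open>V\<close>, expressed by orthogonality so that
    stability under sums and scalars is immediate.\<close>
  define V2 where "V2 = {w. \<forall>z. (\<forall>v\<in>V. cinner v z = 0) \<longrightarrow> cinner w z = 0}"
  have ex: "\<exists>w\<in>V2. (\<forall>y. cinner x (A \<cdot> y) = cinner w (P \<cdot> y)) \<and> norm w \<le> norm x" for x
  proof -
    \<comment> \<open>The choice of preimage is harmless: \<open>P\<close> and \<open>A\<close> give
      vectors of equal norm, so \<open>P \<cdot> y' = P \<cdot> y\<close> forces
      \<open>A \<cdot> y' = A \<cdot> y\<close>.\<close>
    define f where "f v = cinner x (A \<cdot> inv (bop_apply P) v)" for v
    have f: "f (P \<cdot> y) = cinner x (A \<cdot> y)" for y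
    proof -
      define y' where "y' = inv (bop_apply P) (P \<cdot> y)"
      have "P \<cdot> y' = P \<cdot> y" unfolding y'_def by (simp add: f_inv_into_f)
      then have "P \<cdot> (y' - y) = 0" by (simp add: bop_apply_diff)
      then have "A \<cdot> y' = A \<cdot> y" using nPA[of "y' - y"] by (simp add: bop_apply_diff)
      then show ?thesis by (simp add: f_def y'_def)
    qed
    obtain w where w: "w \<in> closure V" "\<And>v. v \<in> V \<Longrightarrow> f v = cinner w v" "norm w \<le> norm x"
    proof (rule Riesz_subspace[of V f "norm x"])
      show "0 \<in> V" unfolding V_def by (rule range_eqI[of _ _ 0]) simp
      show "u + v \<in> V" if "u \<in> V" "v \<in> V" for u v
        using that unfolding V_def by (auto simp flip: bop_apply_simps(8))
      show "c *\<^sub>C v \<in> V" if "v \<in> V" for c v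
        using that unfolding V_def by (auto simp flip: bop_apply_simps(9))
      show "f (u + v) = f u + f v" if "u \<in> V" "v \<in> V" for u v
        using that unfolding V_def
        by (auto simp: f bop_apply_simps(8)[of A] cinner_simps simp flip: bop_apply_simps(8)[of P])
      show "f (c *\<^sub>C v) = c * f v" if "v \<in> V" for c v
        using that unfolding V_def
        by (auto simp: f bop_apply_simps(9)[of A] cinner_simps simp flip: bop_apply_simps(9)[of P])
      show "cmod (f v) \<le> norm x * norm v" if "v \<in> V" for v
        using that unfolding V_def by (auto simp: f nPA cinner_Cauchy_Schwarz)
    qed auto
    have "w \<in> V2"
      unfolding V2_def
    proof (intro CollectI allI impI)
      fix z assume z: "\<forall>v\<in>V. cinner v z = 0"
      obtain v where v: "\<And>n. v n \<in> V" "v \<longlonglongrightarrow> w"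
        using w(1) closure_sequential by blast
      have "(\<lambda>n. cinner (v n) z) \<longlonglongrightarrow> cinner w z"
        by (intro tendsto_intros v)
      then show "cinner w z = 0"
        using z v(1) by (simp add: LIMSEQ_const_iff)
    qed
    then show ?thesis using w(2,3) by (auto simp: V_def simp flip: f)
  qed
  then obtain g where gV: "\<And>x. g x \<in> V2" and g: "\<And>x y. cinner x (A \<cdot> y) = cinner (g x) (P \<cdot> y)"
    and gn: "\<And>x. norm (g x) \<le> norm x"
    by metis
  \<comment> \<open>The difference is orthogonal to \<open>V\<close>, hence to both \<open>u\<close>
    and \<open>w\<close>, hence to itself.\<close>
  have uniq: "u = w" if "u \<in> V2" "w \<in> V2" "\<And>y. cinner u (P \<cdot> y) = cinner w (P \<cdot> y)" for u w
  proof -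
    have "\<forall>v\<in>V. cinner v (u - w) = 0"
      using that(3) unfolding V_def by (auto simp: cinner_simps cinner_commute[of "P \<cdot> _"])
    then have "cinner u (u - w) = 0" "cinner w (u - w) = 0"
      using that(1,2) by (simp_all add: V2_def)
    then have "cinner (u - w) (u - w) = 0" by (simp add: cinner_simps)
    then show ?thesis by (simp add: cinner_self_eq_0)
  qed
  have "\<exists>W. \<forall>x. W \<cdot> x = g x"
  proof (rule bop_existsI[of g 1])
    have "u + w \<in> V2" if "u \<in> V2" "w \<in> V2" for u w
      using that by (auto simp: V2_def cinner_simps)
    then show "g (x + y) = g x + g y" for x y
      by (intro uniq gV) (auto simp: gV cinner_simps simp flip: g)
    have "c *\<^sub>C w \<in> V2" if "w \<in> V2" for c w
      using that by (auto simp: V2_def cinner_simps)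
    then show "g (c *\<^sub>C x) = c *\<^sub>C g x" for c x
      by (intro uniq gV) (auto simp: gV cinner_simps simp flip: g)
  qed (simp add: gn)
  then obtain W where W: "\<And>x. W \<cdot> x = g x" by blast
  have "W * A = P"
  proof (rule bop_eqI)
    fix x
    have "g (A \<cdot> x) = P \<cdot> x"
    proof (rule uniq[OF gV])
      show "P \<cdot> x \<in> V2" by (auto simp: V2_def V_def)
      show "cinner (g (A \<cdot> x)) (P \<cdot> y) = cinner (P \<cdot> x) (P \<cdot> y)" for y
        by (simp add: PA flip: g)
    qed
    then show "(W * A) \<cdot> x = P \<cdot> x" by (simp add: bop_apply_simps W)
  qed
  moreover have "adjoint_op W * P = A"
    by (rule bop_eqI, rule cinner_eqI) (simp add: bop_apply_simps adjoint_op_right W g)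
  moreover have "norm W \<le> 1"
    by (rule norm_bop_bound) (simp_all add: W gn)
  ultimately show ?thesis using that by (simp add: P_def)
qed

section \<open>Orthonormal bases and Hilbert-Schmidt bounds\<close>

lemma orthonormal_basis_exists: "\<exists>E :: 'a::complex_hilbert_space set. orthonormal_basis E"
proof -
  define ON where "ON E \<longleftrightarrow> (\<forall>e\<in>E. norm e = 1) \<and> (\<forall>e\<in>E. \<forall>f\<in>E. e \<noteq> f \<longrightarrow> cinner e f = 0)"
    for E :: "'a set"
  have "\<exists>M\<in>{E. ON E}. \<forall>X\<in>{E. ON E}. M \<subseteq> X \<longrightarrow> X = M"
  proof (rule subset_Zorn')
    fix \<C> assume chain: "subset.chain {E. ON E} \<C>"
    \<comment> \<open>Orthonormality concerns at most two vectors at a time, and two vectors of the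
      union already lie in one member of the chain.\<close>
    have "\<exists>E\<in>\<C>. e \<in> E \<and> f \<in> E" if ef: "e \<in> \<Union>\<C>" "f \<in> \<Union>\<C>" for e f
    proof -
      obtain E F where EF: "E \<in> \<C>" "e \<in> E" "F \<in> \<C>" "f \<in> F" using ef by blast
      then have "E \<subseteq> F \<or> F \<subseteq> E"
        using chain by (auto simp: subset_chain_def)
      then show ?thesis using EF by blast
    qed
    moreover have "ON E" if "E \<in> \<C>" for E
      using chain that by (auto simp: subset_chain_def)
    ultimately show "\<Union>\<C> \<in> {E. ON E}"
      unfolding ON_def by simp blast
  qed
  then obtain M where M: "ON M" and max: "\<And>X. ON X \<Longrightarrow> M \<subseteq> X \<Longrightarrow> X = M"
    by blast
  have "x = 0" if x: "\<forall>e\<in>M. cinner e x = 0" for x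
  proof (rule ccontr)
    assume "x \<noteq> 0"
    define u where "u = inverse (norm x) *\<^sub>R x"
    have u: "norm u = 1" using \<open>x \<noteq> 0\<close> by (simp add: u_def)
    have orth: "cinner e u = 0" "cinner u e = 0" if "e \<in> M" for e
      using x that cinner_commute[of x e] by (simp_all add: u_def cinner_simps)
    have "ON (insert u M)"
      using M u orth by (auto simp: ON_def)
    then have "u \<in> M" using max by blast
    then have "cinner u u = 0" using orth by blast
    then show False using u by (simp add: cinner_self)
  qed
  then have "orthonormal_basis M"
    using M by (auto simp: orthonormal_basis_def ON_def)
  then show ?thesis ..
qed

lemma orthonormal_basis_some_basis: "orthonormal_basis (some_basis :: 'a::complex_hilbert_space set)"
  unfolding some_basis_def by (rule someI_ex[OF orthonormal_basis_exists])

lemma cinner_basis: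
  assumes "orthonormal_basis E" "e \<in> E" "f \<in> E"
  shows "cinner e f = (if e = f then 1 else 0)"
  using assms by (auto simp: orthonormal_basis_def cinner_self)

text \<open>Pythagoras for a partial expansion. The exact defect is kept, not only its sign, because
  Parseval's identity compares two defects.\<close>

lemma Bessel_defect:
  fixes x :: "'a::complex_hilbert_space"
  assumes E: "orthonormal_basis E" and F: "finite F" "F \<subseteq> E"
  shows "(norm (x - (\<Sum>e\<in>F. cinner e x *\<^sub>C e)))\<^sup>2 = (norm x)\<^sup>2 - (\<Sum>e\<in>F. (cmod (cinner e x))\<^sup>2)"
proof -
  define p where "p = (\<Sum>e\<in>F. cinner e x *\<^sub>C e)"
  have "cinner x p = of_real (\<Sum>e\<in>F. (cmod (cinner e x))\<^sup>2)"
    unfolding p_def cinner_sum_right cinner_scaleC_right of_real_sum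
    by (intro sum.cong refl) (metis cinner_commute complex_norm_square)
  moreover have "cinner p x = of_real (\<Sum>e\<in>F. (cmod (cinner e x))\<^sup>2)"
    unfolding p_def cinner_sum_left cinner_scaleC_left of_real_sum
    by (intro sum.cong refl) (metis complex_norm_square mult.commute)
  moreover have "cinner e p = cinner e x" if "e \<in> F" for e
  proof -
    have "cinner e p = (\<Sum>f\<in>F. if e = f then cinner f x else 0)"
      unfolding p_def cinner_sum_right cinner_scaleC_right
      using that F(2) by (intro sum.cong refl) (auto simp: cinner_basis[OF E] subset_iff)
    then show ?thesis using F(1) that by simp
  qed
  then have "cinner p p = of_real (\<Sum>e\<in>F. (cmod (cinner e x))\<^sup>2)"
    by (subst (1) p_def) (auto simp: cinner_sum_left cinner_scaleC_left mult.commute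
        complex_norm_square simp del: of_real_power intro!: sum.cong)
  ultimately have "cinner (x - p) (x - p) = of_real ((norm x)\<^sup>2 - (\<Sum>e\<in>F. (cmod (cinner e x))\<^sup>2))"
    unfolding cinner_diff_left cinner_diff_right by (simp only: cinner_self[of x]) simp
  then show ?thesis
    unfolding p_def[symmetric] power2_norm_eq_cinner[of "x - p"] by simp
qed

lemma Bessel:
  fixes x :: "'a::complex_hilbert_space"
  assumes "orthonormal_basis E" "finite F" "F \<subseteq> E"
  shows "(\<Sum>e\<in>F. (cmod (cinner e x))\<^sup>2) \<le> (norm x)\<^sup>2"
  using Bessel_defect[OF assms, of x] zero_le_power2[of "norm (x - (\<Sum>e\<in>F. cinner e x *\<^sub>C e))"]
  by linarith

text \<open>Beyond Bessel, finite expansions must be dense. Riesz gives \<open>w\<close> in their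
  closure representing \<open>cinner x\<close> on them; then \<open>x - w\<close> is orthogonal to
  the whole basis and vanishes by maximality.\<close>

lemma Parseval:
  fixes x :: "'a::complex_hilbert_space"
  assumes E: "orthonormal_basis E"
  shows "((\<lambda>e. (cmod (cinner e x))\<^sup>2) has_sum (norm x)\<^sup>2) E"
proof -
  \<comment> \<open>Members of the span are encoded as vectors equal to their own expansion over a
    finite set, which fixes the coefficients; enlarging that set then handles sums.\<close>
  define expands where "expands F v \<longleftrightarrow> v = (\<Sum>e\<in>F. cinner e v *\<^sub>C e)" for F and v :: 'a
  define V where "V = {v. \<exists>F. finite F \<and> F \<subseteq> E \<and> expands F v}"
  have scale0: "0 *\<^sub>C e = 0" for e :: 'a
    using scaleR_scaleC[of 0 e] by simp
  have mono: "expands G v" if v: "expands F v" and FG: "F \<subseteq> G" "finite G" "G \<subseteq> E" for F G v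
  proof -
    have "cinner e v = 0" if "e \<in> G - F" for e
    proof -
      have "cinner e v = cinner e (\<Sum>f\<in>F. cinner f v *\<^sub>C f)"
        using v by (simp add: expands_def)
      also have "\<dots> = (\<Sum>f\<in>F. cinner f v * cinner e f)"
        by (simp add: cinner_sum_right cinner_scaleC_right)
      also have "\<dots> = 0"
        using that FG by (intro sum.neutral) (auto simp: cinner_basis[OF E] subset_iff)
      finally show ?thesis .
    qed
    then have "(\<Sum>e\<in>G. cinner e v *\<^sub>C e) = (\<Sum>e\<in>F. cinner e v *\<^sub>C e)"
      using FG by (intro sum.mono_neutral_right) (auto simp: scale0)
    then show ?thesis using v by (simp add: expands_def)
  qed
  have x: "x \<in> closure V"
  proof -
    obtain w where w: "w \<in> closure V" "\<And>v. v \<in> V \<Longrightarrow> cinner x v = cinner w v" "norm w \<le> norm x"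
    proof (rule Riesz_subspace[of V "cinner x" "norm x"])
      show "0 \<in> V"
        unfolding V_def expands_def by (auto intro!: exI[of _ "{}"])
      show "u + v \<in> V" if uv: "u \<in> V" "v \<in> V" for u v
      proof -
        obtain F G where FG: "finite F" "F \<subseteq> E" "expands F u" "finite G" "G \<subseteq> E" "expands G v"
          using uv by (auto simp: V_def)
        then have "expands (F \<union> G) u" "expands (F \<union> G) v"
          by (auto intro: mono[of F u] mono[of G v])
        then have "expands (F \<union> G) (u + v)"
          unfolding expands_def by (simp add: cinner_simps scaleC_add_left sum.distrib)
        then show ?thesis using FG unfolding V_def by (auto intro!: exI[of _ "F \<union> G"])
      qed
      show "c *\<^sub>C v \<in> V" if v: "v \<in> V" for c v
      proof -
        obtain F where F: "finite F" "F \<subseteq> E" "expands F v"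
          using v by (auto simp: V_def)
        have "c *\<^sub>C (\<Sum>e\<in>F. cinner e v *\<^sub>C e) = (\<Sum>e\<in>F. cinner e (c *\<^sub>C v) *\<^sub>C e)"
          by (simp add: linear_sum[OF bounded_linear.linear[OF bounded_linear_scaleC]]
              cinner_simps scaleC_scaleC)
        then have "expands F (c *\<^sub>C v)"
          using F(3) unfolding expands_def by simp
        then show ?thesis using F unfolding V_def by blast
      qed
    qed (auto simp: cinner_simps cinner_Cauchy_Schwarz)
    have "x - w = 0"
    proof -
      have "cinner e (x - w) = 0" if "e \<in> E" for e
      proof -
        have "e \<in> V"
          unfolding V_def expands_def using that
          by (auto intro!: exI[of _ "{e}"] simp: cinner_basis[OF E] scaleC_1)
        then have "cinner (x - w) e = 0" using w(2) by (simp add: cinner_simps)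
        then show ?thesis by (metis cinner_commute complex_cnj_zero)
      qed
      then show ?thesis using E unfolding orthonormal_basis_def by blast
    qed
    then show ?thesis using w(1) by simp
  qed
  have bound: "\<exists>F. finite F \<and> F \<subseteq> E \<and> (norm x)\<^sup>2 - \<epsilon> \<le> (\<Sum>e\<in>F. (cmod (cinner e x))\<^sup>2)"
    if "\<epsilon> > 0" for \<epsilon>
  proof -
    obtain v where v: "v \<in> V" "dist v x < sqrt \<epsilon>"
      using x \<open>\<epsilon> > 0\<close> unfolding closure_approachable by (meson real_sqrt_gt_zero)
    then obtain F where F: "finite F" "F \<subseteq> E" "expands F v" by (auto simp: V_def)
    \<comment> \<open>Since \<open>v\<close> equals its expansion over \<open>F\<close>, subtracting
      it leaves the defect unchanged. The defect of \<open>x\<close> is thus at most the squared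
      distance to \<open>v\<close>.\<close>
    have "x - v - (\<Sum>e\<in>F. cinner e (x - v) *\<^sub>C e)
        = x - (\<Sum>e\<in>F. cinner e x *\<^sub>C e) - (v - (\<Sum>e\<in>F. cinner e v *\<^sub>C e))"
    proof -
      have "cinner e (x - v) *\<^sub>C e = cinner e x *\<^sub>C e - cinner e v *\<^sub>C e" for e
        using scaleC_add_left[of "cinner e (x - v)" "cinner e v" e] by (simp add: cinner_simps)
      then show ?thesis by (simp add: sum_subtractf)
    qed
    also have "\<dots> = x - (\<Sum>e\<in>F. cinner e x *\<^sub>C e)"
      using F(3) by (simp add: expands_def)
    finally have "(norm x)\<^sup>2 - (\<Sum>e\<in>F. (cmod (cinner e x))\<^sup>2)
        = (norm (x - v))\<^sup>2 - (\<Sum>e\<in>F. (cmod (cinner e (x - v)))\<^sup>2)"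
      by (simp only: Bessel_defect[OF E F(1,2), symmetric])
    also have "\<dots> \<le> (norm (x - v))\<^sup>2"
      by (simp add: sum_nonneg)
    also have "\<dots> \<le> (sqrt \<epsilon>)\<^sup>2"
      using v(2) by (intro power_mono) (auto simp: dist_norm norm_minus_commute)
    finally show ?thesis using F \<open>\<epsilon> > 0\<close> by (intro exI[of _ F]) simp
  qed
  have summable: "(\<lambda>e. (cmod (cinner e x))\<^sup>2) summable_on E"
    by (rule nonneg_bdd_above_summable_on) (auto intro!: bdd_aboveI2[of _ _ "(norm x)\<^sup>2"] Bessel[OF E])
  have "infsum (\<lambda>e. (cmod (cinner e x))\<^sup>2) E = (norm x)\<^sup>2"
  proof (rule antisym)
    show "infsum (\<lambda>e. (cmod (cinner e x))\<^sup>2) E \<le> (norm x)\<^sup>2"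
      by (rule infsum_le_finite_sums[OF summable Bessel[OF E]])
    show "(norm x)\<^sup>2 \<le> infsum (\<lambda>e. (cmod (cinner e x))\<^sup>2) E"
    proof (rule field_le_epsilon)
      fix \<epsilon> :: real assume "\<epsilon> > 0"
      from bound[OF this] obtain F where F: "finite F" "F \<subseteq> E"
        "(norm x)\<^sup>2 - \<epsilon> \<le> (\<Sum>e\<in>F. (cmod (cinner e x))\<^sup>2)" by blast
      then show "(norm x)\<^sup>2 \<le> infsum (\<lambda>e. (cmod (cinner e x))\<^sup>2) E + \<epsilon>"
        using finite_sum_le_infsum[OF summable F(1,2)] by simp
    qed
  qed
  then show ?thesis using summable has_sum_infsum by metis
qed

section \<open>Hilbert-Schmidt bounds\<close>

lemma has_sum_finite_sum:
  fixes f :: "'b \<Rightarrow> 'c \<Rightarrow> 'd::topological_comm_monoid_add"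
  assumes "\<And>i. i \<in> I \<Longrightarrow> (f i has_sum s i) A"
  shows "((\<lambda>x. \<Sum>i\<in>I. f i x) has_sum (\<Sum>i\<in>I. s i)) A"
  using assms by (induction I rule: infinite_finite_induct) (auto intro: has_sum_add has_sum_0)

text \<open>\<open>c\<close> bounds the squared Hilbert-Schmidt norm; finite partial sums avoid the junk value of a
  divergent infinite sum.\<close>

definition hilbert_schmidt_le :: "'a::complex_hilbert_space bop \<Rightarrow> real \<Rightarrow> bool"
  where "hilbert_schmidt_le K c \<longleftrightarrow>
    (\<forall>F. finite F \<longrightarrow> F \<subseteq> some_basis \<longrightarrow> (\<Sum>e\<in>F. (norm (K \<cdot> e))\<^sup>2) \<le> c)"

lemma hilbert_schmidt_le_nonneg: "hilbert_schmidt_le K c \<Longrightarrow> 0 \<le> c"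
  unfolding hilbert_schmidt_le_def by (drule spec[of _ "{}"]) simp

text \<open>The double sum of squared matrix entries is symmetric in \<open>K\<close> and its
  adjoint. The exchange is done on finite sets: Parseval in \<open>f\<close>, then Bessel in
  \<open>e\<close> for each fixed \<open>f\<close>.\<close>

lemma hilbert_schmidt_le_adjoint:
  fixes K :: "'a::complex_hilbert_space bop"
  assumes K: "hilbert_schmidt_le K c"
  shows "hilbert_schmidt_le (adjoint_op K) c"
  unfolding hilbert_schmidt_le_def
proof (intro allI impI)
  fix F :: "'a set" assume F: "finite F" "F \<subseteq> some_basis"
  have "((\<lambda>f. \<Sum>e\<in>F. (cmod (cinner f (adjoint_op K \<cdot> e)))\<^sup>2) has_sum (\<Sum>e\<in>F. (norm (adjoint_op K \<cdot> e))\<^sup>2)) some_basis"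
    by (rule has_sum_finite_sum) (rule Parseval[OF orthonormal_basis_some_basis])
  then show "(\<Sum>e\<in>F. (norm (adjoint_op K \<cdot> e))\<^sup>2) \<le> c"
  proof (rule has_sum_le_finite_sums)
    fix G :: "'a set" assume G: "finite G" "G \<subseteq> some_basis"
    have "(\<Sum>f\<in>G. \<Sum>e\<in>F. (cmod (cinner f (adjoint_op K \<cdot> e)))\<^sup>2) \<le> (\<Sum>f\<in>G. (norm (K \<cdot> f))\<^sup>2)"
    proof (rule sum_mono)
      fix f
      have "cmod (cinner f (adjoint_op K \<cdot> e)) = cmod (cinner e (K \<cdot> f))" for e
        by (subst cinner_commute) (simp add: adjoint_op_left)
      then show "(\<Sum>e\<in>F. (cmod (cinner f (adjoint_op K \<cdot> e)))\<^sup>2) \<le> (norm (K \<cdot> f))\<^sup>2"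
        using Bessel[OF orthonormal_basis_some_basis F] by simp
    qed
    also have "\<dots> \<le> c" using K G by (simp add: hilbert_schmidt_le_def)
    finally show "(\<Sum>f\<in>G. \<Sum>e\<in>F. (cmod (cinner f (adjoint_op K \<cdot> e)))\<^sup>2) \<le> c" .
  qed
qed

lemma hilbert_schmidt_le_times_left:
  fixes K B :: "'a::complex_hilbert_space bop"
  assumes K: "hilbert_schmidt_le K c"
  shows "hilbert_schmidt_le (B * K) ((norm B)\<^sup>2 * c)"
  unfolding hilbert_schmidt_le_def
proof (intro allI impI)
  fix F :: "'a set" assume F: "finite F" "F \<subseteq> some_basis"
  have "(\<Sum>e\<in>F. (norm ((B * K) \<cdot> e))\<^sup>2) \<le> (\<Sum>e\<in>F. (norm B)\<^sup>2 * (norm (K \<cdot> e))\<^sup>2)"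
    by (intro sum_mono)
      (simp add: bop_apply_simps norm_bop_apply power_mono flip: power_mult_distrib)
  also have "\<dots> \<le> (norm B)\<^sup>2 * c"
    using K F by (simp add: hilbert_schmidt_le_def mult_left_mono flip: sum_distrib_left)
  finally show "(\<Sum>e\<in>F. (norm ((B * K) \<cdot> e))\<^sup>2) \<le> (norm B)\<^sup>2 * c" .
qed

text \<open>\<open>B\<close> does not preserve the basis, so the bound is reached through adjoints,
  where \<open>B\<close> acts from the left.\<close>

lemma hilbert_schmidt_le_times_right:
  assumes K: "hilbert_schmidt_le K c"
  shows "hilbert_schmidt_le (K * B) ((norm B)\<^sup>2 * c)"
  using hilbert_schmidt_le_adjoint[OF hilbert_schmidt_le_times_left[OF hilbert_schmidt_le_adjoint[OF K],
      of "adjoint_op B"]]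
  by (simp add: adjoint_op_times)

lemma hilbert_schmidt_sum_le:
  fixes K L :: "'a::complex_hilbert_space bop"
  assumes K: "hilbert_schmidt_le K c" and L: "hilbert_schmidt_le L d"
    and F: "finite F" "F \<subseteq> some_basis"
  shows "(\<Sum>e\<in>F. cmod (cinner (K \<cdot> e) (L \<cdot> e))) \<le> sqrt c * sqrt d"
proof -
  have "(\<Sum>e\<in>F. cmod (cinner (K \<cdot> e) (L \<cdot> e))) \<le> (\<Sum>e\<in>F. \<bar>norm (K \<cdot> e)\<bar> * \<bar>norm (L \<cdot> e)\<bar>)"
    by (intro sum_mono) (simp add: cinner_Cauchy_Schwarz)
  also have "\<dots> \<le> L2_set (\<lambda>e. norm (K \<cdot> e)) F * L2_set (\<lambda>e. norm (L \<cdot> e)) F"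
    by (rule L2_set_mult_ineq)
  also have "\<dots> \<le> sqrt c * sqrt d"
    using K L F hilbert_schmidt_le_nonneg[OF K] unfolding L2_set_def hilbert_schmidt_le_def
    by (intro mult_mono) (auto simp: sum_nonneg)
  finally show ?thesis .
qed

text \<open>The coefficients of \<open>K \<cdot> x\<close> are inner products of
  \<open>adjoint_op K \<cdot> e\<close> with \<open>x\<close>, so the bound for the adjoint controls
  them.\<close>

lemma hilbert_schmidt_le_norm:
  fixes K :: "'a::complex_hilbert_space bop"
  assumes "hilbert_schmidt_le K c"
  shows "norm (K \<cdot> x) \<le> sqrt c * norm x"
proof -
  have c: "0 \<le> c" by (rule hilbert_schmidt_le_nonneg[OF assms])
  have "(norm (K \<cdot> x))\<^sup>2 \<le> c * (norm x)\<^sup>2"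
  proof (rule has_sum_le_finite_sums[OF Parseval[OF orthonormal_basis_some_basis]])
    fix F :: "'a set" assume F: "finite F" "F \<subseteq> some_basis"
    have "(\<Sum>e\<in>F. (cmod (cinner e (K \<cdot> x)))\<^sup>2) \<le> (\<Sum>e\<in>F. (norm (adjoint_op K \<cdot> e))\<^sup>2 * (norm x)\<^sup>2)"
    proof (rule sum_mono)
      fix e
      show "(cmod (cinner e (K \<cdot> x)))\<^sup>2 \<le> (norm (adjoint_op K \<cdot> e))\<^sup>2 * (norm x)\<^sup>2"
        using power_mono[OF cinner_Cauchy_Schwarz[of "adjoint_op K \<cdot> e" x], of 2]
        by (simp add: adjoint_op_left power_mult_distrib)
    qed
    also have "\<dots> = (\<Sum>e\<in>F. (norm (adjoint_op K \<cdot> e))\<^sup>2) * (norm x)\<^sup>2"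
      by (simp add: sum_distrib_right)
    also have "\<dots> \<le> c * (norm x)\<^sup>2"
      using hilbert_schmidt_le_adjoint[OF assms] F
      by (intro mult_right_mono) (auto simp: hilbert_schmidt_le_def)
    finally show "(\<Sum>e\<in>F. (cmod (cinner e (K \<cdot> x)))\<^sup>2) \<le> c * (norm x)\<^sup>2" .
  qed
  also have "\<dots> = (sqrt c * norm x)\<^sup>2" using c by (simp add: power_mult_distrib)
  finally show ?thesis by (rule power2_le_imp_le) (simp add: c)
qed

section \<open>Trace class\<close>

text \<open>\<open>R\<close> is the square root of \<open>\<bar>Z\<bar>\<close>, and \<open>Z = W\<^sup>* R R\<close> exhibits \<open>Z\<close> as a product of two
  Hilbert-Schmidt operators.\<close>

lemma trace_class_factor:
  fixes Z :: "'a::complex_hilbert_space bop"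
  assumes Z: "Z \<in> trace_class"
  obtains R W where "positive_op R" "hilbert_schmidt_le R (trace_norm Z)"
    "norm W \<le> 1" "Z = adjoint_op W * (R * R)"
proof -
  obtain R where R: "positive_op R" "R * R = abs_op Z"
    by (rule positive_sqrt_commuting[OF positive_abs_op[of Z]]) (rule that)
  have eq: "Re (cinner e (abs_op Z \<cdot> e)) = (norm (R \<cdot> e))\<^sup>2" for e
    unfolding R(2)[symmetric]
    by (simp add: bop_apply_simps power2_norm_eq_cinner positive_op_hermitian[OF R(1)])
  have summ: "(\<lambda>e. cinner e (abs_op Z \<cdot> e)) summable_on some_basis"
    using Z by (simp add: trace_class_def)
  have "hilbert_schmidt_le R (trace_norm Z)"
    unfolding hilbert_schmidt_le_def
  proof (intro allI impI)
    fix F :: "'a set" assume F: "finite F" "F \<subseteq> some_basis"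
    have "(\<Sum>e\<in>F. Re (cinner e (abs_op Z \<cdot> e))) \<le> infsum (\<lambda>e. Re (cinner e (abs_op Z \<cdot> e))) some_basis"
      using summable_on_Re[OF summ] F by (rule finite_sum_le_infsum) (simp add: eq)
    also have "\<dots> = trace_norm Z"
      by (simp add: trace_norm_def trace_def infsum_Re[OF summ])
    finally show "(\<Sum>e\<in>F. (norm (R \<cdot> e))\<^sup>2) \<le> trace_norm Z" by (simp add: eq)
  qed
  moreover obtain W where "norm W \<le> 1" "adjoint_op W * abs_op Z = Z"
    by (rule polar_contraction[of Z]) (rule that)
  ultimately show ?thesis
    using R by (intro that[of R W]) simp_all
qed

text \<open>Outside the trace class the defining sum diverges and has the value \<open>0\<close>; a metric space
  requires nonnegative distances also there.\<close>

lemma trace_norm_nonneg: "0 \<le> trace_norm Z"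
proof (cases "Z \<in> trace_class")
  case True
  show ?thesis
    by (rule trace_class_factor[OF True]) (rule hilbert_schmidt_le_nonneg)
next
  case False
  then show ?thesis
    by (simp add: trace_norm_def trace_def trace_class_def infsum_not_exists)
qed

text \<open>Two outer factors are carried because \<open>B\<close> will be a polar contraction and
  \<open>A\<close> an observable. Bounding finite sums also delivers absolute summability.\<close>

lemma trace_class_sum_le:
  fixes Z A B :: "'a::complex_hilbert_space bop"
  assumes Z: "Z \<in> trace_class" and F: "finite F" "F \<subseteq> some_basis"
  shows "(\<Sum>e\<in>F. cmod (cinner e ((B * Z * A) \<cdot> e))) \<le> norm B * norm A * trace_norm Z"
proof -
  obtain R W where R: "positive_op R" "hilbert_schmidt_le R (trace_norm Z)"
    and W: "norm W \<le> 1" "Z = adjoint_op W * (R * R)"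
    by (rule trace_class_factor[OF Z]) (rule that)
  note t = trace_norm_nonneg[of Z]
  \<comment> \<open>Everything to the left of the second \<open>R\<close> moves to the first
    argument as its adjoint, leaving one Hilbert-Schmidt operator on each side.\<close>
  have "cinner e ((B * Z * A) \<cdot> e) = cinner ((R * (W * adjoint_op B)) \<cdot> e) ((R * A) \<cdot> e)" for e
    by (simp add: W(2) bop_apply_simps adjoint_op_positive[OF R(1)] flip: adjoint_op_right)
  then have "(\<Sum>e\<in>F. cmod (cinner e ((B * Z * A) \<cdot> e)))
      \<le> sqrt ((norm (W * adjoint_op B))\<^sup>2 * trace_norm Z) * sqrt ((norm A)\<^sup>2 * trace_norm Z)"
    using hilbert_schmidt_sum_le[OF hilbert_schmidt_le_times_right[OF R(2)]
        hilbert_schmidt_le_times_right[OF R(2)] F, of "W * adjoint_op B" A] by simp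
  also have "\<dots> = norm (W * adjoint_op B) * norm A * trace_norm Z"
    using t by (simp add: real_sqrt_mult)
  also have "\<dots> \<le> norm B * norm A * trace_norm Z"
  proof -
    have "norm (W * adjoint_op B) \<le> norm W * norm B"
      using norm_mult_ineq[of W "adjoint_op B"] by simp
    also have "\<dots> \<le> norm B" using mult_right_mono[OF W(1), of "norm B"] by simp
    finally show ?thesis using t by (intro mult_right_mono) auto
  qed
  finally show ?thesis .
qed

lemma trace_class_abs_summable:
  assumes "Z \<in> trace_class"
  shows "(\<lambda>e. cmod (cinner e ((B * Z * A) \<cdot> e))) summable_on some_basis"
  by (rule nonneg_bdd_above_summable_on) (auto intro!: bdd_aboveI2 trace_class_sum_le[OF assms])

lemma trace_class_summable:
  assumes "Z \<in> trace_class"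
  shows "(\<lambda>e. cinner e ((B * Z * A) \<cdot> e)) summable_on some_basis"
  by (rule abs_summable_summable[OF trace_class_abs_summable[OF assms]])

lemma cmod_trace_le:
  assumes "Z \<in> trace_class"
  shows "cmod (trace (B * Z * A)) \<le> norm B * norm A * trace_norm Z"
  unfolding trace_def
  by (rule order_trans[OF norm_infsum_bound[OF trace_class_abs_summable[OF assms]]])
    (rule infsum_le_finite_sums[OF trace_class_abs_summable[OF assms] trace_class_sum_le[OF assms]])

text \<open>Left multiplication by the polar contraction of the combination gives its absolute
  value, whose diagonal thus splits into two summable families. Summability also justifies adding
  the infinite sums.\<close>

lemma trace_class_linear:
  assumes X: "X \<in> trace_class" and Y: "Y \<in> trace_class"
  shows trace_class_scaleR_add: "a *\<^sub>R X + b *\<^sub>R Y \<in> trace_class"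
    and trace_scaleR_add: "trace (B * (a *\<^sub>R X + b *\<^sub>R Y) * A)
      = of_real a * trace (B * X * A) + of_real b * trace (B * Y * A)"
proof -
  have eq: "cinner e ((B * (a *\<^sub>R X + b *\<^sub>R Y) * A) \<cdot> e)
      = of_real a * cinner e ((B * X * A) \<cdot> e) + of_real b * cinner e ((B * Y * A) \<cdot> e)" for e A B
    by (simp add: bop_apply_simps cinner_simps bop_apply_scaleR)
  have summ: "(\<lambda>e. of_real c * cinner e ((B * Z * A) \<cdot> e)) summable_on some_basis"
    if "Z \<in> trace_class" for c Z A B
    by (rule summable_on_cmult_right[OF trace_class_summable[OF that]])
  obtain W where W: "W * (a *\<^sub>R X + b *\<^sub>R Y) = abs_op (a *\<^sub>R X + b *\<^sub>R Y)"
    by (rule polar_contraction) (rule that)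
  show "a *\<^sub>R X + b *\<^sub>R Y \<in> trace_class"
    unfolding trace_class_def mem_Collect_eq W[symmetric]
    using summable_on_add[OF summ[OF X, of a W 1] summ[OF Y, of b W 1]] eq[of _ W 1] by simp
  show "trace (B * (a *\<^sub>R X + b *\<^sub>R Y) * A)
      = of_real a * trace (B * X * A) + of_real b * trace (B * Y * A)"
    unfolding trace_def eq infsum_add[OF summ[OF X] summ[OF Y]]
    by (simp add: infsum_cmult_right trace_class_summable X Y)
qed

lemma trace_class_diff:
  assumes X: "X \<in> trace_class" and Y: "Y \<in> trace_class"
  shows "X - Y \<in> trace_class" "trace ((X - Y) * A) = trace (X * A) - trace (Y * A)"
  using trace_class_scaleR_add[OF X Y, of 1 "-1"] trace_scaleR_add[OF X Y, of 1 1 "-1" A] by simp_all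

text \<open>A single contraction \<open>W\<close>, taken from the polar decomposition of the sum,
  makes the trace norm of the sum a linear expression; each term is then bounded separately.\<close>

lemma trace_norm_triangle:
  assumes X: "X \<in> trace_class" and Y: "Y \<in> trace_class"
  shows "trace_norm (X + Y) \<le> trace_norm X + trace_norm Y"
proof -
  obtain W where W: "norm W \<le> 1" "W * (X + Y) = abs_op (X + Y)"
    by (rule polar_contraction) (rule that)
  have le: "Re (trace (W * Z)) \<le> trace_norm Z" if "Z \<in> trace_class" for Z
  proof -
    have "cmod (trace (W * Z * 1)) \<le> norm W * norm (1 :: 'a bop) * trace_norm Z"
      by (rule cmod_trace_le[OF that])
    also have "\<dots> \<le> 1 * 1 * trace_norm Z"
      using W(1) norm_1_bop_le trace_norm_nonneg[of Z] by (intro mult_mono) auto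
    finally show ?thesis using complex_Re_le_cmod[of "trace (W * Z)"] by simp
  qed
  have "trace_norm (X + Y) = Re (trace (W * X)) + Re (trace (W * Y))"
    using trace_scaleR_add[OF X Y, of W 1 1 1] by (simp add: trace_norm_def W(2))
  then show ?thesis using le[OF X] le[OF Y] by simp
qed

text \<open>Each of the two factors \<open>R\<close> contributes a square root of the trace norm.
  The inequality yields definiteness of the metric and carries positivity to limits.\<close>

lemma norm_le_trace_norm:
  fixes Z :: "'a::complex_hilbert_space bop"
  assumes Z: "Z \<in> trace_class"
  shows "norm Z \<le> trace_norm Z"
proof (rule norm_bop_bound[OF trace_norm_nonneg[of Z]])
  fix x
  obtain R W where R: "hilbert_schmidt_le R (trace_norm Z)"
    and W: "norm W \<le> 1" "Z = adjoint_op W * (R * R)"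
    by (rule trace_class_factor[OF Z]) (rule that)
  note t = trace_norm_nonneg[of Z]
  have "norm (Z \<cdot> x) \<le> norm (adjoint_op W) * norm (R \<cdot> R \<cdot> x)"
    using norm_bop_apply by (subst W(2)) (simp add: bop_apply_simps del: norm_adjoint_op)
  also have "\<dots> \<le> 1 * (sqrt (trace_norm Z) * (sqrt (trace_norm Z) * norm x))"
    using W(1) t by (intro mult_mono order_trans[OF hilbert_schmidt_le_norm[OF R]]
        mult_left_mono hilbert_schmidt_le_norm[OF R]) auto
  finally show "norm (Z \<cdot> x) \<le> trace_norm Z * norm x"
    using t by (simp flip: mult.assoc)
qed

lemma trace_norm_0 [simp]: "trace_norm 0 = 0"
  by (simp add: trace_norm_def trace_def bop_apply_simps)

lemma Metric_space_trace_norm: "Metric_space trace_class (\<lambda>X Y. trace_norm (X - Y))"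
proof
  fix X Y Z :: "'a bop"
  show "0 \<le> trace_norm (X - Y)"
    by (rule trace_norm_nonneg)
  show "trace_norm (X - Y) = trace_norm (Y - X)"
    using abs_op_uminus[of "X - Y"] by (simp add: trace_norm_def)
  assume X: "X \<in> trace_class" and Y: "Y \<in> trace_class"
  show "trace_norm (X - Y) = 0 \<longleftrightarrow> X = Y"
    using norm_le_trace_norm[OF trace_class_diff(1)[OF X Y]] by auto
  assume Z: "Z \<in> trace_class"
  show "trace_norm (X - Z) \<le> trace_norm (X - Y) + trace_norm (Y - Z)"
    using trace_norm_triangle[OF trace_class_diff(1)[OF X Y] trace_class_diff(1)[OF Y Z]] by simp
qed

section \<open>Invariant density operators\<close>

lemma convex_invariant_densities: "convex (invariant_densities T)"
  unfolding convex_def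
proof (intro ballI allI impI)
  fix \<rho> \<sigma> :: "'a bop" and u v :: real
  assume \<rho>: "\<rho> \<in> invariant_densities T" and \<sigma>: "\<sigma> \<in> invariant_densities T"
    and uv: "0 \<le> u" "0 \<le> v" "u + v = 1"
  have tc: "\<rho> \<in> trace_class" "\<sigma> \<in> trace_class"
    using \<rho> \<sigma> by (auto simp: invariant_densities_def density_operators_def)
  have tr: "trace ((u *\<^sub>R \<rho> + v *\<^sub>R \<sigma>) * A) = of_real u * trace (\<rho> * A) + of_real v * trace (\<sigma> * A)" for A
    using trace_scaleR_add[OF tc, of 1 u v A] by simp
  have "trace (u *\<^sub>R \<rho> + v *\<^sub>R \<sigma>) = of_real (u + v)"
    using tr[of 1] \<rho> \<sigma> by (simp add: invariant_densities_def density_operators_def)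
  moreover have "positive_op (u *\<^sub>R \<rho> + v *\<^sub>R \<sigma>)"
    using \<rho> \<sigma> uv
    by (intro positive_op_add positive_op_scaleR) (auto simp: invariant_densities_def density_operators_def)
  ultimately show "u *\<^sub>R \<rho> + v *\<^sub>R \<sigma> \<in> invariant_densities T"
    using \<rho> \<sigma> trace_class_scaleR_add[OF tc]
    by (simp add: invariant_densities_def density_operators_def tr uv(3))
qed

text \<open>A difference of two traces covers normalisation and invariance alike, as both equate
  such a difference with a constant. Approximants in place of sequences match the ball criterion for
  closedness.\<close>

lemma trace_norm_approx_trace_eq:
  assumes X: "X \<in> trace_class"
    and approx: "\<And>r. r > 0 \<Longrightarrow> \<exists>Y\<in>trace_class. trace_norm (X - Y) < r \<and> trace (Y * A) - trace (Y * B) = c"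
  shows "trace (X * A) - trace (X * B) = c"
proof (rule ccontr)
  define d where "d = cmod (trace (X * A) - trace (X * B) - c)"
  \<comment> \<open>A Lipschitz constant of the trace difference, enlarged by 1 so that it can be
    divided by even when \<open>A\<close> and \<open>B\<close> vanish.\<close>
  define M where "M = norm (1 :: 'a bop) * norm A + norm (1 :: 'a bop) * norm B + 1"
  have M: "M > 0"
    unfolding M_def by (intro add_nonneg_pos add_nonneg_nonneg mult_nonneg_nonneg) auto
  assume "\<not> ?thesis"
  then have "d / M > 0" using M by (simp add: d_def)
  then obtain Y where Y: "Y \<in> trace_class" "trace_norm (X - Y) < d / M"
    "trace (Y * A) - trace (Y * B) = c" using approx by blast
  have Z: "X - Y \<in> trace_class" by (rule trace_class_diff(1)[OF X Y(1)])
  have "trace (X * A) - trace (X * B) - c = trace ((X - Y) * A) - trace ((X - Y) * B)"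
    by (simp add: trace_class_diff(2)[OF X Y(1)] flip: Y(3))
  then have "d \<le> cmod (trace ((X - Y) * A)) + cmod (trace ((X - Y) * B))"
    unfolding d_def by (metis norm_triangle_ineq4)
  also have "\<dots> \<le> (M - 1) * trace_norm (X - Y)"
    using cmod_trace_le[OF Z, of 1 A] cmod_trace_le[OF Z, of 1 B] by (simp add: M_def algebra_simps)
  also have "\<dots> \<le> M * trace_norm (X - Y)"
    by (intro mult_right_mono trace_norm_nonneg) simp
  also have "\<dots> < d"
    using Y(2) M by (simp add: field_simps)
  finally show False by simp
qed

text \<open>Each diagonal value is continuous in the operator norm, hence in the trace norm, and the
  nonnegative reals are closed in the complex plane.\<close>

lemma trace_norm_approx_positive:
  assumes X: "X \<in> trace_class"
    and approx: "\<And>r. r > 0 \<Longrightarrow> \<exists>Y\<in>trace_class. trace_norm (X - Y) < r \<and> positive_op Y"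
  shows "positive_op X"
  unfolding positive_op_def
proof
  fix x
  have "cinner x (X \<cdot> x) \<in> closure \<real>\<^sub>\<ge>\<^sub>0"
    unfolding closure_approachable
  proof (intro allI impI)
    fix e :: real assume "e > 0"
    \<comment> \<open>The summand 1 keeps the radius meaningful for \<open>x = 0\<close>.\<close>
    then have "e / (norm x * norm x + 1) > 0" by (simp add: add_nonneg_pos)
    then obtain Y where Y: "Y \<in> trace_class" "trace_norm (X - Y) < e / (norm x * norm x + 1)"
      "positive_op Y" using approx by blast
    have "dist (cinner x (Y \<cdot> x)) (cinner x (X \<cdot> x)) = cmod (cinner x ((X - Y) \<cdot> x))"
      by (simp add: dist_norm norm_minus_commute bop_apply_simps cinner_simps)
    also have "\<dots> \<le> norm (X - Y) * (norm x * norm x)"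
      using cmod_cinner_bop_le[of x "X - Y" x] by (simp add: mult_ac)
    also have "\<dots> \<le> trace_norm (X - Y) * (norm x * norm x + 1)"
      using norm_le_trace_norm[OF trace_class_diff(1)[OF X Y(1)]] trace_norm_nonneg
      by (intro mult_mono) auto
    also have "\<dots> < e"
      using Y(2) by (simp add: pos_less_divide_eq add_nonneg_pos)
    finally show "\<exists>y\<in>\<real>\<^sub>\<ge>\<^sub>0. dist y (cinner x (X \<cdot> x)) < e"
      using Y(3) by (auto simp: positive_op_def)
  qed
  then show "cinner x (X \<cdot> x) \<in> \<real>\<^sub>\<ge>\<^sub>0"
    using closed_nonneg_Reals_complex by simp
qed

lemma closedin_invariant_densities: "closedin trace_norm_topology (invariant_densities T)"
  unfolding trace_norm_topology_def Metric_space.closedin_metric[OF Metric_space_trace_norm]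
proof (intro conjI allI impI)
  show "invariant_densities T \<subseteq> trace_class"
    by (auto simp: invariant_densities_def density_operators_def)
  fix X assume X: "X \<in> trace_class - invariant_densities T"
  show "\<exists>r>0. disjnt (invariant_densities T)
      (Metric_space.mball trace_class (\<lambda>X Y. trace_norm (X - Y)) X r)"
  proof (rule ccontr)
    assume "\<not> ?thesis"
    \<comment> \<open>If no ball about \<open>X\<close> avoids the set, invariant densities
      approximate \<open>X\<close> arbitrarily well, and every defining condition passes to
      \<open>X\<close>.\<close>
    then have approx: "\<exists>Y\<in>invariant_densities T. trace_norm (X - Y) < r" if "r > 0" for r
      using that by (fastforce simp: disjnt_iff Metric_space.in_mball[OF Metric_space_trace_norm])
    have Xtc: "X \<in> trace_class" using X by blast
    have "positive_op X"
      using approx by (intro trace_norm_approx_positive[OF Xtc])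
        (fastforce simp: invariant_densities_def density_operators_def)
    \<comment> \<open>The zero operator makes the second trace vanish, which brings normalisation
      into the form of a difference.\<close>
    moreover have "trace (X * 1) - trace (X * 0) = 1"
      using approx by (intro trace_norm_approx_trace_eq[OF Xtc])
        (fastforce simp: invariant_densities_def density_operators_def trace_def bop_apply_simps)
    then have "trace X = 1" by (simp add: trace_def bop_apply_simps)
    moreover have "trace (X * T t A) - trace (X * A) = 0" if "t \<ge> 0" for t A
      using approx that by (intro trace_norm_approx_trace_eq[OF Xtc])
        (fastforce simp: invariant_densities_def density_operators_def)
    ultimately have "X \<in> invariant_densities T"
      using Xtc by (simp add: invariant_densities_def density_operators_def)
    then show False using X by blast
  qed
qed

theorem proposition2:
  fixes T :: "real \<Rightarrow> 'h::complex_hilbert_space bop \<Rightarrow>\<^sub>L 'h bop"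
    and S :: "real \<Rightarrow> 'h bop \<Rightarrow> 'h bop"
  assumes "quantum_dynamical_semigroup T"
    and "uniformly_continuous_semigroup T"
    and "\<forall>t\<ge>0. T t 1 = 1"
    and "dual_semigroup T S"
    and "uniformly_continuous_dual S"
  shows "convex (invariant_densities T) \<and>
    closedin trace_norm_topology (invariant_densities T)"
  by (intro conjI convex_invariant_densities closedin_invariant_densities)

end
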